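(* Let $\sigma>1$ be an integer, $\omega$ a primitive $\sigma$-th root of unity, $G$ a matrix of rank $r$ with column set $E$, and $\mathbb{A}$ of order $q$, in the setting described in the context. For a binary operation $\circ$ on subsets of $E$ and $k=0,\dots,\sigma-1$, let $\mathcal{M}^\circ(k,\sigma)$ be the set of pairs $(f,g)$ of functions $f,g:E\to\mathbb{A}$ such that $f-g$ is a flow of $G$ over $\mathbb{A}$ and $|\mathrm{supp}(f)\circ\mathrm{supp}(g)|\equiv k\pmod\sigma$. Then: (a) $\sum_{k=0}^{\sigma-1}\omega^k|\mathcal{M}^\cup(k,\sigma)| = (1-\omega)^r(\omega q)^{|E|-r}R\!\left(M(G);\frac{\omega q^2}{1-\omega},\frac{1-\omega}{\omega q}\right)$. (b) If $2+\omega(q-2)\ne0$, then $\sum_{k=0}^{\sigma-1}\omega^k|\mathcal{M}^\cap(k,\sigma)| = (\omega-1)^r(2+\omega(q-2))^{|E|-r}R\!\left(M(G);\frac{q(2+\omega(q-2))}{\omega-1},\frac{\omega-1}{2+\omega(q-2)}\right)$. (c) If $2\omega+q-2\ne0$, then $\sum_{k=0}^{\sigma-1}\omega^k|\mathcal{M}^\Delta(k,\sigma)| = (2-2\omega)^r(2\omega+q-2)^{|E|-r}R\!\left(M(G);\frac{q(2\omega+q-2)}{2-2\omega},\frac{2-2\omega}{2\omega+q-2}\right)$. (d) $\sum_{k=0}^{\sigma-1}\omega^k|\mathcal{M}^{|}(k,\sigma)| = (\omega-1)^rq^{|E|-r}R\!\left(M(G);\frac{q^2}{\omega-1},\frac{\omega-1}{q}\right)$.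 (e) If $1+\omega(q-1)\ne0$, then $\sum_{k=0}^{\sigma-1}\omega^k|\mathcal{M}^{\to}(k,\sigma)| = (\omega-1)^r(1+\omega(q-1))^{|E|-r}R\!\left(M(G);\frac{q(1+\omega(q-1))}{\omega-1},\frac{\omega-1}{1+\omega(q-1)}\right)$.
   Context: Set operations on subsets $A,B\subseteq E$: $\cup$ union, $\cap$ intersection, $\Delta$ symmetric difference, Sheffer stroke $A\,|\,B=E\setminus(A\cup B)$, implication $A\to B=(E\setminus A)\cup B$. Setting (the paper's hypothesis "$G$ is a totally-$\mathbb{P}$ matrix and $\mathbb{A}$ a $\mathbb{P}$-module of order $q$", read as the following cases): either (i) $G$ is the vertex–edge or cycle–edge matrix of a graph with edge set $E$, or a totally unimodular matrix, and $\mathbb{A}$ is an Abelian group of order $q$; or (ii) $G$ is a matrix over $\mathrm{GF}(p^s)$, $\mathbb{A}=\mathrm{GF}(p^s)^d$, $q=p^{sd}$. With $H$ a matrix orthogonally dual to $G$ (same columns, rows of $H$ orthogonal to rows of $G$, ranks summing to $|E|$; integer in case (i)), a flow of $G$ over $\mathbb{A}$ is $h:E\to\mathbb{A}$ with $Hh^T=0$ (equivalently an $\mathbb{A}$-combination of rows of $G$). $\mathrm{supp}(f)=\{e: f(e)\ne0\}$. $M(G)$ is the matroid on $E$ of linear dependence of the columns of $G$, rank function $\mathrm{rk}$, rank $r$; $R(M;\lambda,x)=\sum_{B\subseteq E}\lambda^{r-\mathrm{rk}(B)}x^{|B|-\mathrm{rk}(B)}$.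
   Formalization: In case (i) the integer dual H is also required to be primitive (its rows generate over the integers all integer vectors orthogonal to G); without this (a) fails for E={e}, G=[0], H=[2], A=Z/2, where flows are not the A-combinations of rows of G. *)

theory Defs
  imports
    "HOL-Analysis.Finite_Cartesian_Product"
    "HOL-Library.FuncSet"
    "HOL-Number_Theory.Cong"
    "Jordan_Normal_Form.Determinant"
    "Graph_Theory.Arc_Walk"
begin

text \<open>A matrix with row index set \<open>I\<close> and column set \<open>E\<close> is a function
  \<open>G :: 'i \<Rightarrow> 'e \<Rightarrow> 'k\<close> used only on \<open>I\<close> and \<open>E\<close>, so that \<open>I\<close> or \<open>E\<close> may be empty and
  distinct edges may have equal columns.\<close>

section \<open>The column matroid and its rank polynomial\<close>

definition column_matroid :: "'i set \<Rightarrow> ('i \<Rightarrow> 'e \<Rightarrow> 'k::field) \<Rightarrow> 'e set \<Rightarrow> bool" where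
  "column_matroid I G X \<longleftrightarrow>
     (\<forall>c. (\<forall>i\<in>I. (\<Sum>e\<in>X. c e * G i e) = 0) \<longrightarrow> (\<forall>e\<in>X. c e = 0))"

text \<open>A matroid on \<open>E\<close> is given by its independence predicate.\<close>

definition matroid_rank :: "('e set \<Rightarrow> bool) \<Rightarrow> 'e set \<Rightarrow> nat" where
  "matroid_rank indep B = Max {card X | X. X \<subseteq> B \<and> indep X}"

definition rank_polynomial :: "'e set \<Rightarrow> ('e set \<Rightarrow> bool) \<Rightarrow> complex \<Rightarrow> complex \<Rightarrow> complex" where
  "rank_polynomial E indep l x =
     (\<Sum>B\<in>Pow E. l ^ (matroid_rank indep E - matroid_rank indep B)
               * x ^ (card B - matroid_rank indep B))"

section \<open>The integer matrices\<close>

abbreviation rat_matrix :: "('i \<Rightarrow> 'e \<Rightarrow> int) \<Rightarrow> 'i \<Rightarrow> 'e \<Rightarrow> rat" where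
  "rat_matrix G \<equiv> (\<lambda>i e. rat_of_int (G i e))"

definition totally_unimodular :: "'i set \<Rightarrow> 'e set \<Rightarrow> ('i \<Rightarrow> 'e \<Rightarrow> int) \<Rightarrow> bool" where
  "totally_unimodular I E G \<longleftrightarrow>
     (\<forall>n r c. r ` {..<n} \<subseteq> I \<and> inj_on r {..<n} \<and> c ` {..<n} \<subseteq> E \<and> inj_on c {..<n}
        \<longrightarrow> Determinant.det (Matrix.mat n n (\<lambda>(a, b). G (r a) (c b))) \<in> {-1, 0, 1})"

text \<open>A graph (loops and parallel edges allowed) with an arbitrary reference orientation is a
  \<open>fin_digraph\<close> whose arcs are the edges. A loop has zero column in the vertex-edge matrix.\<close>

definition vertex_edge_matrix ::
  "('v, 'e) pre_digraph \<Rightarrow> 'i set \<Rightarrow> 'e set \<Rightarrow> ('i \<Rightarrow> 'e \<Rightarrow> int) \<Rightarrow> bool" where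
  "vertex_edge_matrix D I E G \<longleftrightarrow> fin_digraph D \<and> arcs D = E \<and>
     (\<exists>v. bij_betw v I (verts D) \<and>
       (\<forall>i\<in>I. \<forall>e\<in>E. G i e = of_bool (head D e = v i) - of_bool (tail D e = v i)))"

text \<open>Each edge \<open>e\<close> is split into \<open>(e, True)\<close>, traversing \<open>e\<close> along its orientation, and
  \<open>(e, False)\<close>, traversing it backwards.\<close>

definition both_directions :: "('v, 'e) pre_digraph \<Rightarrow> ('v, 'e \<times> bool) pre_digraph" where
  "both_directions D = \<lparr> verts = verts D, arcs = arcs D \<times> UNIV,
     tail = (\<lambda>(e, b). if b then tail D e else head D e),
     head = (\<lambda>(e, b). if b then head D e else tail D e) \<rparr>"

text \<open>The second condition excludes going back and forth along one edge.\<close>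

definition undirected_cycle :: "('v, 'e) pre_digraph \<Rightarrow> ('e \<times> bool) list \<Rightarrow> bool" where
  "undirected_cycle D p \<longleftrightarrow>
     pre_digraph.cycle (both_directions D) p \<and> distinct (map fst p)"

text \<open>One row for each cycle (identified with its edge set), with an arbitrary direction of
  traversal chosen for each.\<close>

definition cycle_edge_matrix ::
  "('v, 'e) pre_digraph \<Rightarrow> 'i set \<Rightarrow> 'e set \<Rightarrow> ('i \<Rightarrow> 'e \<Rightarrow> int) \<Rightarrow> bool" where
  "cycle_edge_matrix D I E G \<longleftrightarrow> fin_digraph D \<and> arcs D = E \<and>
     (\<exists>p. (\<forall>i\<in>I. undirected_cycle D (p i)) \<and>
       bij_betw (\<lambda>i. fst ` set (p i)) I {fst ` set c | c. undirected_cycle D c} \<and>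
       (\<forall>i\<in>I. \<forall>e\<in>E. G i e = of_bool ((e, True) \<in> set (p i)) - of_bool ((e, False) \<in> set (p i))))"

section \<open>Orthogonal duality and flows\<close>

definition orthogonally_dual ::
  "'i set \<Rightarrow> 'j set \<Rightarrow> 'e set \<Rightarrow> ('i \<Rightarrow> 'e \<Rightarrow> 'k::field) \<Rightarrow> ('j \<Rightarrow> 'e \<Rightarrow> 'k) \<Rightarrow> bool" where
  "orthogonally_dual I J E G H \<longleftrightarrow>
     (\<forall>j\<in>J. \<forall>i\<in>I. (\<Sum>e\<in>E. H j e * G i e) = 0) \<and>
     matroid_rank (column_matroid I G) E + matroid_rank (column_matroid J H) E = card E"

text \<open>An integer dual must also be primitive: its rows generate, over the integers, every
  integer vector orthogonal to \<open>G\<close>. Otherwise \<open>H\<close> could be replaced by \<open>2 H\<close>, whose kernel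
  over a group of order 2 is everything. The condition holds whenever \<open>H\<close> is totally
  unimodular, or \<open>G\<close> and \<open>H\<close> are the vertex-edge and cycle-edge matrices of one graph (in
  either order).\<close>

definition int_orthogonally_dual ::
  "'i set \<Rightarrow> 'j set \<Rightarrow> 'e set \<Rightarrow> ('i \<Rightarrow> 'e \<Rightarrow> int) \<Rightarrow> ('j \<Rightarrow> 'e \<Rightarrow> int) \<Rightarrow> bool" where
  "int_orthogonally_dual I J E G H \<longleftrightarrow>
     orthogonally_dual I J E (rat_matrix G) (rat_matrix H) \<and>
     (\<forall>x. (\<forall>i\<in>I. (\<Sum>e\<in>E. x e * G i e) = 0)
        \<longrightarrow> (\<exists>c. \<forall>e\<in>E. x e = (\<Sum>j\<in>J. c j * H j e)))"

text \<open>The action of the integers on an abelian group.\<close>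

definition int_scale :: "int \<Rightarrow> 'a::ab_group_add \<Rightarrow> 'a" where
  "int_scale n a = (\<Sum>_<nat n. a) - (\<Sum>_<nat (- n). a)"

definition is_flow ::
  "('k \<Rightarrow> 'a \<Rightarrow> 'a) \<Rightarrow> 'j set \<Rightarrow> 'e set \<Rightarrow> ('j \<Rightarrow> 'e \<Rightarrow> 'k) \<Rightarrow> ('e \<Rightarrow> 'a::ab_group_add) \<Rightarrow> bool" where
  "is_flow smul J E H h \<longleftrightarrow> (\<forall>j\<in>J. (\<Sum>e\<in>E. smul (H j e) (h e)) = 0)"

section \<open>Pairs of functions differing by a flow\<close>

definition supp :: "'e set \<Rightarrow> ('e \<Rightarrow> 'a::zero) \<Rightarrow> 'e set" where
  "supp E f = {e\<in>E. f e \<noteq> 0}"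

definition sheffer :: "'e set \<Rightarrow> 'e set \<Rightarrow> 'e set \<Rightarrow> 'e set" where
  "sheffer E A B = E - (A \<union> B)"

definition set_imp :: "'e set \<Rightarrow> 'e set \<Rightarrow> 'e set \<Rightarrow> 'e set" where
  "set_imp E A B = (E - A) \<union> B"

definition flow_pairs ::
  "'e set \<Rightarrow> (('e \<Rightarrow> 'a::ab_group_add) \<Rightarrow> bool) \<Rightarrow> ('e set \<Rightarrow> 'e set \<Rightarrow> 'e set) \<Rightarrow> nat \<Rightarrow> nat
     \<Rightarrow> (('e \<Rightarrow> 'a) \<times> ('e \<Rightarrow> 'a)) set" where
  "flow_pairs E flow opr k \<sigma> =
     {(f, g). f \<in> E \<rightarrow>\<^sub>E UNIV \<and> g \<in> E \<rightarrow>\<^sub>E UNIV \<and> flow (\<lambda>e. f e - g e) \<and>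
        [card (opr (supp E f) (supp E g)) = k] (mod \<sigma>)}"

definition root_sum ::
  "nat \<Rightarrow> complex \<Rightarrow> 'e set \<Rightarrow> (('e \<Rightarrow> 'a::ab_group_add) \<Rightarrow> bool)
     \<Rightarrow> ('e set \<Rightarrow> 'e set \<Rightarrow> 'e set) \<Rightarrow> complex" where
  "root_sum \<sigma> \<omega> E flow opr = (\<Sum>k<\<sigma>. \<omega> ^ k * of_nat (card (flow_pairs E flow opr k \<sigma>)))"

definition primitive_root_of_unity :: "nat \<Rightarrow> complex \<Rightarrow> bool" where
  "primitive_root_of_unity \<sigma> \<omega> \<longleftrightarrow> \<omega> ^ \<sigma> = 1 \<and> (\<forall>j. 0 < j \<and> j < \<sigma> \<longrightarrow> \<omega> ^ j \<noteq> 1)"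

end

theory Submission
  imports Defs
begin

text \<open>Writing \<open>f = g + h\<close> with \<open>h\<close> a flow and summing over \<open>g\<close> edge by edge turns the sum of the
  \<open>\<omega> ^ |supp f \<circ> supp g|\<close> into a sum over flows \<open>h\<close> of a product over the edges whose factor is one
  constant \<open>u + w\<close> where \<open>h\<close> vanishes and another constant \<open>w\<close> elsewhere. Expanding the product
  gives the sum over \<open>B \<subseteq> E\<close> of \<open>u ^ |B| * w ^ |E - B|\<close> times the number of flows vanishing on \<open>B\<close>,
  and that number is \<open>q ^ (r - rk B)\<close>.

  For the last count, take a maximal independent set \<open>X\<close> of columns in \<open>B\<close> and extend it to a maximal
  independent set \<open>Y\<close> in \<open>E\<close>. The flows are the functions annihilating every linear relation
  between the columns, and the relations are spanned by those expressing a single column through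
  \<open>Y\<close>, which have coefficients in the base ring. So a flow is given by arbitrary values on \<open>Y\<close>, and it
  vanishes on \<open>B\<close> iff it vanishes on \<open>X\<close>.\<close>

section \<open>Independent columns\<close>

text \<open>The independence predicate of \<open>column_matroid\<close> over an arbitrary
  commutative ring, so that integer matrices can be treated with integer coefficients.\<close>

definition independent_columns :: "'i set \<Rightarrow> ('i \<Rightarrow> 'e \<Rightarrow> 'k::comm_ring_1) \<Rightarrow> 'e set \<Rightarrow> bool" where
  "independent_columns I G X \<longleftrightarrow>
     (\<forall>c. (\<forall>i\<in>I. (\<Sum>e\<in>X. c e * G i e) = 0) \<longrightarrow> (\<forall>e\<in>X. c e = 0))"

lemma independent_columnsD:
  assumes "independent_columns I G X" "\<And>i. i \<in> I \<Longrightarrow> (\<Sum>e\<in>X. c e * G i e) = 0" "e \<in> X"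
  shows "c e = 0"
  using assms(1)[unfolded independent_columns_def, rule_format, of c e] assms(2,3) by simp

lemma column_matroid_eq_independent_columns: "column_matroid = independent_columns"
  by (simp add: fun_eq_iff column_matroid_def independent_columns_def)

lemma independent_columns_subset:
  assumes "independent_columns I G Y" "X \<subseteq> Y" "finite Y"
  shows "independent_columns I G X"
  unfolding independent_columns_def
proof (intro allI impI ballI)
  fix c e assume c: "\<forall>i\<in>I. (\<Sum>e\<in>X. c e * G i e) = 0" and "e \<in> X"
  have "(\<Sum>e\<in>Y. (if e \<in> X then c e else 0) * G i e) = (\<Sum>e\<in>X. c e * G i e)" for i
    using assms by (intro sum.mono_neutral_cong_right) auto
  with c have "(\<Sum>e\<in>Y. (if e \<in> X then c e else 0) * G i e) = 0" if "i \<in> I" for i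
    using that by simp
  from independent_columnsD[OF assms(1) this, of e] \<open>e \<in> X\<close> assms(2) show "c e = 0" by auto
qed

lemma independent_columns_empty: "independent_columns I G {}"
  by (simp add: independent_columns_def)

text \<open>Clearing denominators turns a rational relation between integer columns into an integer
  one with the same zero coefficients. Hence the matroid over the rationals can be studied with
  integer relations only.\<close>

lemma independent_columns_rat_matrix:
  assumes "finite X"
  shows "independent_columns I (rat_matrix G) X \<longleftrightarrow> independent_columns I G X"
proof
  assume ind: "independent_columns I (rat_matrix G) X"
  show "independent_columns I G X"
    unfolding independent_columns_def
  proof (intro allI impI)
    fix c assume c: "\<forall>i\<in>I. (\<Sum>e\<in>X. c e * G i e) = 0"
    have "(\<Sum>e\<in>X. rat_of_int (c e) * rat_matrix G i e) = 0" if "i \<in> I" for i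
    proof -
      have "(\<Sum>e\<in>X. rat_of_int (c e) * rat_matrix G i e) = rat_of_int (\<Sum>e\<in>X. c e * G i e)"
        by simp
      also have "\<dots> = 0" using c that by (simp del: of_int_sum)
      finally show ?thesis .
    qed
    from independent_columnsD[OF ind this] show "\<forall>e\<in>X. c e = 0" by simp
  qed
next
  assume ind: "independent_columns I G X"
  show "independent_columns I (rat_matrix G) X"
    unfolding independent_columns_def
  proof (intro allI impI ballI)
    fix c e assume c: "\<forall>i\<in>I. (\<Sum>e\<in>X. c e * rat_matrix G i e) = 0" and e: "e \<in> X"
    \<comment> \<open>\<open>N\<close> is the product of all denominators. \<open>d e\<close> equals
      \<open>N * c e\<close>, written as the numerator of \<open>c e\<close> times the other
      denominators so that it is visibly an integer.\<close>
    define N where "N = (\<Prod>e\<in>X. snd (quotient_of (c e)))"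
    define d where "d e = fst (quotient_of (c e)) * (\<Prod>f\<in>X-{e}. snd (quotient_of (c f)))" for e
    have pos: "snd (quotient_of x) > 0" for x by (rule quotient_of_denom_pos')
    have N: "N > 0" unfolding N_def by (rule prod_pos) (use pos in auto)
    have d: "rat_of_int (d e) = of_int N * c e" if "e \<in> X" for e
    proof -
      have "N = snd (quotient_of (c e)) * (\<Prod>f\<in>X-{e}. snd (quotient_of (c f)))"
        unfolding N_def using that assms by (rule prod.remove[rotated])
      moreover have "c e = of_int (fst (quotient_of (c e))) / of_int (snd (quotient_of (c e)))"
        by (rule quotient_of_div) simp
      ultimately show ?thesis
        using pos[of "c e"] unfolding d_def
        by (simp add: field_simps)
    qed
    have "(\<Sum>e\<in>X. d e * G i e) = 0" if "i \<in> I" for i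
    proof -
      have "rat_of_int (\<Sum>e\<in>X. d e * G i e) = (\<Sum>e\<in>X. of_int (d e) * rat_matrix G i e)" by simp
      also have "\<dots> = (\<Sum>e\<in>X. of_int N * (c e * rat_matrix G i e))"
        by (intro sum.cong refl) (simp add: d mult.assoc)
      also have "\<dots> = of_int N * (\<Sum>e\<in>X. c e * rat_matrix G i e)"
        by (simp add: sum_distrib_left)
      also have "\<dots> = 0" using c that by simp
      finally show ?thesis by (simp only: of_int_eq_0_iff)
    qed
    from independent_columnsD[OF ind this e] have "d e = 0" .
    with d[OF e] N show "c e = 0" by simp
  qed
qed

section \<open>Rank and maximal independent sets\<close>

lemma matroid_rank_attained:
  assumes "finite B" "indep {}"
  obtains X where "X \<subseteq> B" "indep X" "card X = matroid_rank indep B"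
    "\<And>Z. Z \<subseteq> B \<Longrightarrow> indep Z \<Longrightarrow> card Z \<le> card X"
proof -
  let ?S = "{card X | X. X \<subseteq> B \<and> indep X}"
  have fin: "finite ?S" using assms(1) by simp
  have "?S \<noteq> {}" using assms(2) by blast
  with fin have "Max ?S \<in> ?S" by (rule Max_in)
  then obtain X where X: "X \<subseteq> B" "indep X" "card X = Max ?S" by auto
  moreover have "card Z \<le> card X" if "Z \<subseteq> B" "indep Z" for Z
    unfolding X(3) by (rule Max_ge[OF fin]) (use that in auto)
  ultimately show thesis using that unfolding matroid_rank_def by metis
qed

lemma exists_maximal_independent_superset:
  assumes "finite E" "X \<subseteq> E" "indep X"
  obtains Y where "X \<subseteq> Y" "Y \<subseteq> E" "indep Y" "\<And>e. e \<in> E - Y \<Longrightarrow> \<not> indep (insert e Y)"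
proof -
  let ?S = "{Y. X \<subseteq> Y \<and> Y \<subseteq> E \<and> indep Y}"
  have "finite ?S" using assms(1) by simp
  moreover have "X \<in> ?S" using assms by simp
  ultimately have "\<exists>Y\<in>?S. X \<subseteq> Y \<and> (\<forall>Z\<in>?S. Y \<subseteq> Z \<longrightarrow> Y = Z)"
    by (rule finite_has_maximal2)
  then obtain Y where Y: "Y \<in> ?S" and max: "\<forall>Z\<in>?S. Y \<subseteq> Z \<longrightarrow> Y = Z"
    by (elim bexE conjE)
  have "\<not> indep (insert e Y)" if "e \<in> E - Y" for e
  proof
    assume "indep (insert e Y)"
    with Y that have "insert e Y \<in> ?S" by auto
    with max have "Y = insert e Y" by blast
    with that show False by blast
  qed
  then show thesis using that[of Y] Y by simp
qed

text \<open>The only consequence of unimodularity that the proof needs; over a field it always holds.\<close>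

definition ring_closed_columns ::
  "'i set \<Rightarrow> 'e set \<Rightarrow> ('i \<Rightarrow> 'e \<Rightarrow> 'k::comm_ring_1) \<Rightarrow> bool" where
  "ring_closed_columns I E G \<longleftrightarrow>
     (\<forall>X e. X \<subseteq> E \<and> independent_columns I G X \<and> e \<in> E - X \<and> \<not> independent_columns I G (insert e X)
        \<longrightarrow> (\<exists>c. \<forall>i\<in>I. G i e = (\<Sum>x\<in>X. c x * G i x)))"

text \<open>In a nontrivial relation on \<open>insert e X\<close> the coefficient of
  \<open>e\<close> is nonzero, since otherwise \<open>X\<close> would be dependent. Dividing by it
  solves for the column of \<open>e\<close>.\<close>

lemma ring_closed_columns_field:
  fixes G :: "'i \<Rightarrow> 'e \<Rightarrow> 'k::field"
  assumes "finite E"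
  shows "ring_closed_columns I E G"
  unfolding ring_closed_columns_def
proof (intro allI impI, elim conjE)
  fix X e assume X: "X \<subseteq> E" "independent_columns I G X" and e: "e \<in> E - X"
    and dep: "\<not> independent_columns I G (insert e X)"
  have fin: "finite X" using X(1) assms finite_subset by blast
  from dep obtain c where c: "\<And>i. i \<in> I \<Longrightarrow> (\<Sum>x\<in>insert e X. c x * G i x) = 0"
    and nz: "\<exists>x\<in>insert e X. c x \<noteq> 0"
    unfolding independent_columns_def by blast
  have s: "c e * G i e + (\<Sum>x\<in>X. c x * G i x) = 0" if "i \<in> I" for i
    using c[OF that] e fin by simp
  have "c e \<noteq> 0"
  proof
    assume "c e = 0"
    with s X(2) have "\<forall>x\<in>X. c x = 0" unfolding independent_columns_def by simp
    with \<open>c e = 0\<close> nz show False by auto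
  qed
  have "G i e = (\<Sum>x\<in>X. (- c x / c e) * G i x)" if "i \<in> I" for i
  proof -
    have "(\<Sum>x\<in>X. (- c x / c e) * G i x) = - (\<Sum>x\<in>X. c x * G i x) / c e"
      by (simp add: sum_divide_distrib sum_negf)
    also have "\<dots> = G i e" using s[OF that] \<open>c e \<noteq> 0\<close>
      by (simp add: field_simps add_eq_0_iff)
    finally show ?thesis by simp
  qed
  then show "\<exists>c. \<forall>i\<in>I. G i e = (\<Sum>x\<in>X. c x * G i x)"
    by (intro exI[of _ "\<lambda>x. - c x / c e"]) simp
qed

section \<open>Functions annihilating the relations between columns\<close>

text \<open>The flows described through \<open>G\<close> alone, without a dual matrix: every
  relation between the columns must hold between the values of \<open>h\<close> as well.\<close>

definition annihilating_functions ::
  "('k::comm_ring_1 \<Rightarrow> 'a \<Rightarrow> 'a) \<Rightarrow> 'i set \<Rightarrow> 'e set \<Rightarrow> ('i \<Rightarrow> 'e \<Rightarrow> 'k) \<Rightarrow> ('e \<Rightarrow> 'a::ab_group_add) set" where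
  "annihilating_functions smul I E G =
     {h \<in> E \<rightarrow>\<^sub>E UNIV. \<forall>x. (\<forall>i\<in>I. (\<Sum>e\<in>E. x e * G i e) = 0) \<longrightarrow> (\<Sum>e\<in>E. smul (x e) (h e)) = 0}"

text \<open>The expansions of single columns through \<open>Y\<close> are themselves relations, so
  \<open>h\<close> must respect them. Conversely they suffice, because any relation becomes trivial
  once every column is replaced by its expansion.\<close>

lemma annihilating_functions_iff:
  fixes smul :: "'k::comm_ring_1 \<Rightarrow> 'a::ab_group_add \<Rightarrow> 'a"
  assumes "Modules.module smul" and fin: "finite E"
    and Y: "Y \<subseteq> E" "independent_columns I G Y"
    and c: "\<And>e i. e \<in> E \<Longrightarrow> i \<in> I \<Longrightarrow> G i e = (\<Sum>y\<in>Y. c e y * G i y)"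
  shows "h \<in> annihilating_functions smul I E G \<longleftrightarrow>
    h \<in> E \<rightarrow>\<^sub>E UNIV \<and> (\<forall>e\<in>E. h e = (\<Sum>y\<in>Y. smul (c e y) (h y)))"
proof -
  interpret Modules.module smul by fact
  have finY: "finite Y" using Y(1) fin finite_subset by blast
  show ?thesis
  proof safe
    fix e assume h: "h \<in> annihilating_functions smul I E G" and e: "e \<in> E"
    \<comment> \<open>The relation "column \<open>e\<close> minus its expansion through
      \<open>Y\<close>". If \<open>e\<close> lies in \<open>Y\<close>, both terms contribute at
      \<open>e\<close>.\<close>
    define x where "x f = of_bool (f = e) - (if f \<in> Y then c e f else 0)" for f
    have "(\<Sum>f\<in>E. x f * G i f) = 0" if "i \<in> I" for i
    proof -
      have "(\<Sum>f\<in>E. x f * G i f)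
        = (\<Sum>f\<in>E. (if f = e then G i f else 0)) - (\<Sum>f\<in>E. if f \<in> Y then c e f * G i f else 0)"
        unfolding x_def sum_subtractf[symmetric]
        by (intro sum.cong) (auto simp: algebra_simps)
      also have "(\<Sum>f\<in>E. (if f = e then G i f else 0)) = G i e" using fin e by simp
      also have "(\<Sum>f\<in>E. if f \<in> Y then c e f * G i f else 0) = (\<Sum>f\<in>Y. c e f * G i f)"
        using fin Y(1) by (simp add: sum.If_cases Int_absorb1)
      finally show ?thesis using c[OF e that] by simp
    qed
    with h have "(\<Sum>f\<in>E. smul (x f) (h f)) = 0"
      unfolding annihilating_functions_def by blast
    moreover have "(\<Sum>f\<in>E. smul (x f) (h f))
        = (\<Sum>f\<in>E. (if f = e then h f else 0)) - (\<Sum>f\<in>E. if f \<in> Y then smul (c e f) (h f) else 0)"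
      unfolding x_def sum_subtractf[symmetric]
      by (intro sum.cong) (auto simp: algebra_simps)
    moreover have "(\<Sum>f\<in>E. (if f = e then h f else 0)) = h e" using fin e by simp
    moreover have "(\<Sum>f\<in>E. if f \<in> Y then smul (c e f) (h f) else 0) = (\<Sum>f\<in>Y. smul (c e f) (h f))"
      using fin Y(1) by (simp add: sum.If_cases Int_absorb1)
    ultimately show "h e = (\<Sum>y\<in>Y. smul (c e y) (h y))" by simp
  next
    assume h: "h \<in> E \<rightarrow>\<^sub>E UNIV" "\<forall>e\<in>E. h e = (\<Sum>y\<in>Y. smul (c e y) (h y))"
    have "(\<Sum>e\<in>E. smul (x e) (h e)) = 0" if x: "\<forall>i\<in>I. (\<Sum>e\<in>E. x e * G i e) = 0" for x
    proof -
      \<comment> \<open>Inserting the expansions into the relation \<open>x\<close> leaves a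
        relation between the columns of \<open>Y\<close>, whose coefficients vanish by
        independence.\<close>
      have "(\<Sum>y\<in>Y. (\<Sum>e\<in>E. x e * c e y) * G i y) = 0" if "i \<in> I" for i
      proof -
        have "(\<Sum>y\<in>Y. (\<Sum>e\<in>E. x e * c e y) * G i y) = (\<Sum>e\<in>E. x e * (\<Sum>y\<in>Y. c e y * G i y))"
          unfolding sum_distrib_left sum_distrib_right
          by (subst sum.swap) (simp add: mult.assoc)
        also have "\<dots> = (\<Sum>e\<in>E. x e * G i e)"
          by (intro sum.cong refl) (simp add: c[OF _ that, symmetric])
        finally show ?thesis using x that by simp
      qed
      then have z: "\<forall>y\<in>Y. (\<Sum>e\<in>E. x e * c e y) = 0"
        using independent_columnsD[OF Y(2), where c = "\<lambda>y. \<Sum>e\<in>E. x e * c e y"] by blast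
      have "(\<Sum>e\<in>E. smul (x e) (h e)) = (\<Sum>e\<in>E. \<Sum>y\<in>Y. smul (x e * c e y) (h y))"
        by (intro sum.cong refl) (subst h(2)[rule_format], auto simp: scale_sum_right)
      also have "\<dots> = (\<Sum>y\<in>Y. smul (\<Sum>e\<in>E. x e * c e y) (h y))"
        unfolding scale_sum_left by (rule sum.swap)
      also have "\<dots> = 0" using z by simp
      finally show ?thesis .
    qed
    with h(1) show "h \<in> annihilating_functions smul I E G"
      unfolding annihilating_functions_def by blast
  qed (auto simp: annihilating_functions_def)
qed

text \<open>If the columns of \<open>B\<close> are expanded through \<open>X\<close> only, vanishing
  on \<open>B\<close> is the same as vanishing on \<open>X\<close>. The values on
  \<open>Y - X\<close> then remain free and determine the function.\<close>

lemma card_annihilating_functions_vanishing: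
  fixes smul :: "'k::comm_ring_1 \<Rightarrow> 'a::{ab_group_add,finite} \<Rightarrow> 'a"
  assumes mod: "Modules.module smul" and fin: "finite E" and cl: "ring_closed_columns I E G"
    and B: "B \<subseteq> E" and X: "X \<subseteq> B" "\<And>e. e \<in> B - X \<Longrightarrow> \<not> independent_columns I G (insert e X)"
    and Y: "X \<subseteq> Y" "Y \<subseteq> E" "independent_columns I G Y"
      "\<And>e. e \<in> E - Y \<Longrightarrow> \<not> independent_columns I G (insert e Y)"
  shows "card {h \<in> annihilating_functions smul I E G. \<forall>e\<in>B. h e = 0} = CARD('a) ^ (card Y - card X)"
proof -
  interpret Modules.module smul by fact
  have finY: "finite Y" using Y(2) fin finite_subset by blast
  have finX: "finite X" using Y(1) finY finite_subset by blast
  have indX: "independent_columns I G X"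
    using independent_columns_subset[OF Y(3) Y(1) finY] .
  \<comment> \<open>Three choices of coefficients: a unit vector if \<open>e\<close> is in
    \<open>Y\<close> and not in \<open>B - X\<close>; an expansion through \<open>X\<close>, padded
    with zeros, if \<open>e\<close> is in \<open>B - X\<close>; an expansion through
    \<open>Y\<close> otherwise.\<close>
  have "\<exists>d. (\<forall>i\<in>I. G i e = (\<Sum>y\<in>Y. d y * G i y)) \<and> (e \<in> B \<longrightarrow> (\<forall>y\<in>Y-X. d y = 0))" if e: "e \<in> E" for e
  proof (cases "e \<in> Y \<and> (e \<in> B \<longrightarrow> e \<in> X)")
    case True
    have "(\<Sum>y\<in>Y. of_bool (y = e) * G i y) = G i e" for i
      using True finY by (simp add: of_bool_def if_distrib[of "\<lambda>x. x * _"] cong: if_cong)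
    with True show ?thesis by (intro exI[of _ "\<lambda>y. of_bool (y = e)"]) auto
  next
    case False
    show ?thesis
    proof (cases "e \<in> B")
      case True
      then have "e \<in> B - X" using False Y(1) by auto
      then obtain d where d: "\<And>i. i \<in> I \<Longrightarrow> G i e = (\<Sum>x\<in>X. d x * G i x)"
        using cl[unfolded ring_closed_columns_def, rule_format, of X e] X(1) X(2)[of e] indX B e
        by blast
      have "(\<Sum>y\<in>Y. (if y \<in> X then d y else 0) * G i y) = (\<Sum>x\<in>X. d x * G i x)" for i
        using Y(1) finY by (intro sum.mono_neutral_cong_right) auto
      then show ?thesis using d
        by (intro exI[of _ "\<lambda>y. if y \<in> X then d y else 0"]) auto
    next
      case nB: False
      then have "e \<in> E - Y" using False e by auto
      then show ?thesis
        using cl[unfolded ring_closed_columns_def, rule_format, of Y e] Y(2,3) Y(4)[of e] nB by blast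
    qed
  qed
  then have "\<forall>e\<in>E. \<exists>d. (\<forall>i\<in>I. G i e = (\<Sum>y\<in>Y. d y * G i y)) \<and> (e \<in> B \<longrightarrow> (\<forall>y\<in>Y-X. d y = 0))"
    by blast
  from bchoice[OF this] obtain c where
    "\<forall>e\<in>E. (\<forall>i\<in>I. G i e = (\<Sum>y\<in>Y. c e y * G i y)) \<and> (e \<in> B \<longrightarrow> (\<forall>y\<in>Y-X. c e y = 0))"
    by blast
  then have c: "\<And>e i. e \<in> E \<Longrightarrow> i \<in> I \<Longrightarrow> G i e = (\<Sum>y\<in>Y. c e y * G i y)"
    and cB: "\<And>e y. e \<in> B \<Longrightarrow> y \<in> Y - X \<Longrightarrow> c e y = 0"
    using B by blast+
  \<comment> \<open>Independence makes the expansion through \<open>Y\<close> unique, so a column of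
    \<open>Y\<close> can only be expanded as itself.\<close>
  have delta: "c e y = of_bool (y = e)" if e: "e \<in> Y" and y: "y \<in> Y" for e y
  proof -
    have "(\<Sum>y\<in>Y. (c e y - of_bool (y = e)) * G i y) = 0" if "i \<in> I" for i
    proof -
      have "(\<Sum>y\<in>Y. of_bool (y = e) * G i y) = G i e"
        using e finY by (simp add: of_bool_def if_distrib[of "\<lambda>x. x * _"] cong: if_cong)
      then show ?thesis using c[of e i] e Y(2) that
        by (auto simp: left_diff_distrib sum_subtractf)
    qed
    from independent_columnsD[OF Y(3) this y] show ?thesis by simp
  qed
  note iff = annihilating_functions_iff[OF mod fin Y(2,3) c]
  let ?F = "{h \<in> annihilating_functions smul I E G. \<forall>e\<in>B. h e = 0}"
  let ?P = "(Y - X) \<rightarrow>\<^sub>E (UNIV :: 'a set)"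
  \<comment> \<open>The inverse of restriction: put 0 on \<open>X\<close>, keep \<open>k\<close> on
    \<open>Y - X\<close>, and extend to \<open>E\<close> by the expansions. The terms for
    \<open>X\<close> are zero and therefore omitted from the sum.\<close>
  define ext where "ext k = (\<lambda>e\<in>E. \<Sum>y\<in>Y-X. smul (c e y) (k y))" for k :: "_ \<Rightarrow> 'a"
  have "bij_betw (\<lambda>h. restrict h (Y - X)) ?F ?P"
  proof (rule bij_betw_byWitness[where f' = ext])
    show "\<forall>h\<in>?F. ext (restrict h (Y - X)) = h"
    proof
      fix h assume "h \<in> ?F"
      then have h: "h \<in> E \<rightarrow>\<^sub>E UNIV" "\<And>e. e \<in> E \<Longrightarrow> h e = (\<Sum>y\<in>Y. smul (c e y) (h y))"
        "\<And>e. e \<in> X \<Longrightarrow> h e = 0"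
        using iff[of h] X(1) by auto
      have "(\<Sum>y\<in>Y. smul (c e y) (h y)) = (\<Sum>y\<in>Y-X. smul (c e y) (h y))" for e
        using h(3) finY by (intro sum.mono_neutral_right) auto
      then show "ext (restrict h (Y - X)) = h"
        using h(1) h(2)[symmetric] unfolding ext_def
        by (auto simp: fun_eq_iff PiE_def extensional_def)
    qed
    show "\<forall>k\<in>?P. restrict (ext k) (Y - X) = k"
    proof
      fix k assume k: "k \<in> ?P"
      have "ext k y = k y" if "y \<in> Y - X" for y
      proof -
        have "ext k y = (\<Sum>z\<in>Y-X. if z = y then k z else 0)"
          using that Y(2) unfolding ext_def by (auto simp: delta intro!: sum.cong)
        also have "\<dots> = k y" using that finY by simp
        finally show ?thesis .
      qed
      then show "restrict (ext k) (Y - X) = k"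
        using k by (auto simp: fun_eq_iff PiE_def extensional_def)
    qed
    show "ext ` ?P \<subseteq> ?F"
    proof
      fix h assume "h \<in> ext ` ?P"
      then obtain k where h: "h = ext k" by blast
      have "h e = (\<Sum>y\<in>Y. smul (c e y) (h y))" if e: "e \<in> E" for e
      proof -
        have "h y = (\<Sum>z\<in>Y-X. if z = y then k z else 0)" if "y \<in> Y" for y
          using that Y(2) unfolding h ext_def by (auto simp: delta intro!: sum.cong)
        then have hy: "h y = (if y \<in> Y - X then k y else 0)" if "y \<in> Y" for y
          using that finY by simp
        have "h e = (\<Sum>y\<in>Y-X. smul (c e y) (k y))" using e by (simp add: h ext_def)
        also have "\<dots> = (\<Sum>y\<in>Y. smul (c e y) (h y))"
          using hy finY by (intro sum.mono_neutral_cong_left) auto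
        finally show ?thesis .
      qed
      moreover have "h \<in> E \<rightarrow>\<^sub>E UNIV" unfolding h ext_def by auto
      moreover have "h e = 0" if "e \<in> B" for e
        using that B cB[OF that] unfolding h ext_def by auto
      ultimately show "h \<in> ?F" using iff by auto
    qed
    show "(\<lambda>h. restrict h (Y - X)) ` ?F \<subseteq> ?P"
      by (rule image_subsetI, subst restrict_PiE_iff, simp)
  qed
  then have "card ?F = card ?P" by (rule bij_betw_same_card)
  also have "\<dots> = CARD('a) ^ card (Y - X)" using finY by (simp add: card_funcsetE)
  finally show ?thesis using Y(1) finX by (simp add: card_Diff_subset)
qed

text \<open>Two maximal independent sets \<open>Y\<close> are equicardinal because both give \<open>CARD('a) ^ card Y\<close>
  annihilating functions, so no exchange argument is needed; if \<open>CARD('a) = 1\<close>, both sides are 1.\<close>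

lemma card_annihilating_functions_rank:
  fixes smul :: "'k::comm_ring_1 \<Rightarrow> 'a::{ab_group_add,finite} \<Rightarrow> 'a"
  assumes mod: "Modules.module smul" and fin: "finite E" and cl: "ring_closed_columns I E G"
    and B: "B \<subseteq> E"
  shows "card {h \<in> annihilating_functions smul I E G. \<forall>e\<in>B. h e = 0}
    = CARD('a) ^ (matroid_rank (independent_columns I G) E - matroid_rank (independent_columns I G) B)"
proof -
  let ?ind = "independent_columns I G"
  have max: "\<not> ?ind (insert e X)"
    if "C \<subseteq> E" "X \<subseteq> C" "\<forall>Z. Z \<subseteq> C \<longrightarrow> ?ind Z \<longrightarrow> card Z \<le> card X" "e \<in> C - X" for e X C
  proof
    assume "?ind (insert e X)"
    with that have "card (insert e X) \<le> card X" by blast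
    moreover have "finite X" using that fin by (meson finite_subset)
    ultimately show False using that(4) by simp
  qed
  obtain X where X: "X \<subseteq> B" "?ind X" "card X = matroid_rank ?ind B"
    "\<And>Z. Z \<subseteq> B \<Longrightarrow> ?ind Z \<Longrightarrow> card Z \<le> card X"
    using matroid_rank_attained[of B ?ind] finite_subset[OF B fin] independent_columns_empty by metis
  obtain Y0 where Y0: "Y0 \<subseteq> E" "?ind Y0" "card Y0 = matroid_rank ?ind E"
    "\<And>Z. Z \<subseteq> E \<Longrightarrow> ?ind Z \<Longrightarrow> card Z \<le> card Y0"
    using matroid_rank_attained[of E ?ind] fin independent_columns_empty by metis
  \<comment> \<open>\<open>Y0\<close> attains the rank of \<open>E\<close> but need not contain
    \<open>X\<close>; \<open>Y\<close> contains \<open>X\<close> but is so far only known to be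
    maximal under inclusion.\<close>
  obtain Y where Y: "X \<subseteq> Y" "Y \<subseteq> E" "?ind Y" "\<And>e. e \<in> E - Y \<Longrightarrow> \<not> ?ind (insert e Y)"
    using exists_maximal_independent_superset[of E X ?ind] fin X B by (metis subset_trans)
  have count: "card {h \<in> annihilating_functions smul I E G. \<forall>e\<in>{}. h e = 0} = CARD('a) ^ card Z"
    if "Z \<subseteq> E" "?ind Z" "\<And>e. e \<in> E - Z \<Longrightarrow> \<not> ?ind (insert e Z)" for Z
    using card_annihilating_functions_vanishing[OF mod fin cl, of "{}" "{}" Z] that by simp
  have "CARD('a) ^ card Y = CARD('a) ^ card Y0"
    using count[of Y] count[of Y0] Y max[of E Y0] Y0 by (metis (no_types, lifting) order_refl)
  moreover have "CARD('a) = 1 \<or> CARD('a) > 1"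
    using zero_less_card_finite[where 'a = 'a] by linarith
  ultimately have "CARD('a) = 1 \<or> card Y = card Y0"
    using power_inject_exp by blast
  moreover have "card {h \<in> annihilating_functions smul I E G. \<forall>e\<in>B. h e = 0}
    = CARD('a) ^ (card Y - card X)"
    by (rule card_annihilating_functions_vanishing[OF mod fin cl B X(1) _ Y])
      (use max[OF B X(1)] X(4) in blast)
  ultimately show ?thesis using X(3) Y0(3) by (metis power_one)
qed

section \<open>Unimodularity of the integer matrices\<close>

lemma mat_delete_mat:
  "mat_delete (mat (Suc n) (Suc n) f) i j =
    mat n n (\<lambda>(a, b). f (if a < i then a else Suc a, if b < j then b else Suc b))"
  unfolding mat_delete_def by (intro eq_matI) auto

text \<open>Laplace expansion along the last row. Its cofactors do not involve that row, so one
  \<open>k\<close> serves every bordering row \<open>i\<close>, and the last cofactor, with sign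
  \<open>(-1) ^ (n + n)\<close>, is the original minor.\<close>

lemma det_bordered_expansion:
  fixes G :: "'i \<Rightarrow> 'e \<Rightarrow> 'k::comm_ring_1"
  obtains k where "k n = det (mat n n (\<lambda>(a, b). G (r a) (c b)))"
    "\<And>i. det (mat (Suc n) (Suc n) (\<lambda>(a, b). G ((r(n := i)) a) (c b))) = (\<Sum>b<Suc n. k b * G i (c b))"
proof -
  define k where "k b = (-1) ^ (n + b) *
    det (mat n n (\<lambda>(a, b'). G (r a) (c (if b' < b then b' else Suc b'))))" for b
  have "k n = (-1) ^ (2 * n) * det (mat n n (\<lambda>(a, b'). G (r a) (c (if b' < n then b' else Suc b'))))"
    by (simp add: k_def mult_2)
  also have "mat n n (\<lambda>(a, b'). G (r a) (c (if b' < n then b' else Suc b')))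
      = mat n n (\<lambda>(a, b). G (r a) (c b))"
    by (intro eq_matI) auto
  finally have "k n = det (mat n n (\<lambda>(a, b). G (r a) (c b)))" by simp
  moreover have "det (mat (Suc n) (Suc n) (\<lambda>(a, b). G ((r(n := i)) a) (c b)))
      = (\<Sum>b<Suc n. k b * G i (c b))" for i
  proof -
    let ?M = "mat (Suc n) (Suc n) (\<lambda>(a, b). G ((r(n := i)) a) (c b))"
    have "det ?M = (\<Sum>b<Suc n. ?M $$ (n, b) * cofactor ?M n b)"
      by (rule laplace_expansion_row) auto
    also have "\<dots> = (\<Sum>b<Suc n. k b * G i (c b))"
    proof (intro sum.cong refl)
      fix b assume "b \<in> {..<Suc n}"
      have "mat_delete ?M n b = mat n n (\<lambda>(a, b'). G (r a) (c (if b' < b then b' else Suc b')))"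
        unfolding mat_delete_mat by (intro eq_matI) auto
      then show "?M $$ (n, b) * cofactor ?M n b = k b * G i (c b)"
        using \<open>b \<in> {..<Suc n}\<close> by (simp add: cofactor_def k_def)
    qed
    finally show ?thesis .
  qed
  ultimately show thesis using that by blast
qed

lemma independent_columns_image:
  assumes "independent_columns I G (c ` {..<n})" "inj_on c {..<n}"
    "\<And>i. i \<in> I \<Longrightarrow> (\<Sum>b<n. k b * G i (c b)) = 0" "b < n"
  shows "k b = 0"
proof -
  have inv: "inv_into {..<n} c (c b) = b" if "b < n" for b
    using assms(2) that by simp
  have "(\<Sum>e\<in>c ` {..<n}. k (inv_into {..<n} c e) * G i e) = (\<Sum>b<n. k b * G i (c b))" for i
    by (subst sum.reindex[OF assms(2)]) (simp add: inv)
  then have "k (inv_into {..<n} c (c b)) = 0"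
    using independent_columnsD[OF assms(1), where c = "\<lambda>e. k (inv_into {..<n} c e)" and e = "c b"]
      assms(3,4) by simp
  with inv assms(4) show ?thesis by simp
qed

text \<open>Induction on \<open>n\<close>: if no row bordered a nonzero minor to a larger one, the cofactors would be
  a linear relation between the columns.\<close>

lemma exists_nonzero_minor:
  fixes G :: "'i \<Rightarrow> 'e \<Rightarrow> 'k::comm_ring_1"
  assumes "independent_columns I G (c ` {..<n})" "inj_on c {..<n}"
  obtains r where "r ` {..<n} \<subseteq> I" "inj_on r {..<n}"
    "det (mat n n (\<lambda>(a, b). G (r a) (c b))) \<noteq> 0"
proof -
  \<comment> \<open>Injectivity of \<open>r\<close> is left out of the induction. It follows at the
    end, since a repeated row would make the determinant zero.\<close>
  have "\<exists>r. r ` {..<n} \<subseteq> I \<and> det (mat n n (\<lambda>(a, b). G (r a) (c b))) \<noteq> 0"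
    using assms
  proof (induction n)
    case 0
    then show ?case by simp
  next
    case (Suc n)
    have "independent_columns I G (c ` {..<n})"
      by (rule independent_columns_subset[OF Suc.prems(1)]) auto
    moreover have "inj_on c {..<n}"
      using Suc.prems(2) by (rule inj_on_subset) auto
    ultimately obtain r where r: "r ` {..<n} \<subseteq> I" "det (mat n n (\<lambda>(a, b). G (r a) (c b))) \<noteq> 0"
      using Suc.IH by blast
    obtain k where k: "k n = det (mat n n (\<lambda>(a, b). G (r a) (c b)))"
      "\<And>i. det (mat (Suc n) (Suc n) (\<lambda>(a, b). G ((r(n := i)) a) (c b))) = (\<Sum>b<Suc n. k b * G i (c b))"
      by (rule det_bordered_expansion[where n = n and G = G and r = r and c = c]) (rule that)
    have "\<exists>i\<in>I. (\<Sum>b<Suc n. k b * G i (c b)) \<noteq> 0"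
    proof (rule ccontr)
      assume "\<not> ?thesis"
      then have "k n = 0"
        using independent_columns_image[OF Suc.prems, of k n] by blast
      with k(1) r(2) show False by simp
    qed
    then obtain i where i: "i \<in> I"
      "det (mat (Suc n) (Suc n) (\<lambda>(a, b). G ((r(n := i)) a) (c b))) \<noteq> 0"
      using k(2) by metis
    moreover have "(r(n := i)) ` {..<Suc n} \<subseteq> I" using r(1) i(1) by auto
    ultimately show ?case by blast
  qed
  then obtain r where r: "r ` {..<n} \<subseteq> I" "det (mat n n (\<lambda>(a, b). G (r a) (c b))) \<noteq> 0"
    by blast
  have "inj_on r {..<n}"
  proof (rule inj_onI, rule ccontr)
    fix a a' assume a: "a \<in> {..<n}" "a' \<in> {..<n}" "r a = r a'" "a \<noteq> a'"
    have "Matrix.row (mat n n (\<lambda>(a, b). G (r a) (c b))) a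
        = Matrix.row (mat n n (\<lambda>(a, b). G (r a) (c b))) a'"
      using a by (intro eq_vecI) auto
    then have "det (mat n n (\<lambda>(a, b). G (r a) (c b))) = 0"
      using det_identical_rows[of "mat n n (\<lambda>(a, b). G (r a) (c b))" n a a'] a by auto
    with r(2) show False by simp
  qed
  with r that show thesis by blast
qed

text \<open>Cramer's rule: \<open>X\<close> has a nonzero minor, which is 1 or -1. Adding column
  \<open>e\<close> and any row gives a singular matrix, and expanding its determinant along that row
  yields a relation in which column \<open>e\<close> has this minor as coefficient. The minor is its
  own inverse, so the solution is integral.\<close>

lemma ring_closed_columns_totally_unimodular:
  assumes fin: "finite E" and tu: "totally_unimodular I E G"
  shows "ring_closed_columns I E G"
  unfolding ring_closed_columns_def
proof (intro allI impI, elim conjE)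
  fix X e assume X: "X \<subseteq> E" "independent_columns I G X" and e: "e \<in> E - X"
    and dep: "\<not> independent_columns I G (insert e X)"
  have finX: "finite X" using X(1) fin finite_subset by blast
  then obtain c0 where c0: "bij_betw c0 {0..<card X} X" using ex_bij_betw_nat_finite by blast
  define n where "n = card X"
  define c where "c = c0(n := e)"
  have cX: "bij_betw c {..<n} X"
    using c0 by (subst bij_betw_cong[of _ _ c0]) (auto simp: c_def n_def lessThan_atLeast0)
  have ce: "c n = e" by (simp add: c_def)
  have im: "c ` {..<n} = X" and inj: "inj_on c {..<n}" using cX by (auto simp: bij_betw_def)
  have inj': "inj_on c {..<Suc n}" and im': "c ` {..<Suc n} = insert e X"
    using inj im ce e by (auto simp: lessThan_Suc)
  obtain r where r: "r ` {..<n} \<subseteq> I" "inj_on r {..<n}"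
    "det (mat n n (\<lambda>(a, b). G (r a) (c b))) \<noteq> 0"
    using exists_nonzero_minor[of I G c n] X(2) im inj by metis
  obtain k where k: "k n = det (mat n n (\<lambda>(a, b). G (r a) (c b)))"
    "\<And>i. det (mat (Suc n) (Suc n) (\<lambda>(a, b). G ((r(n := i)) a) (c b))) = (\<Sum>b<Suc n. k b * G i (c b))"
    by (rule det_bordered_expansion[where n = n and G = G and r = r and c = c]) (rule that)
  have "c ` {..<n} \<subseteq> E" using im X(1) by simp
  then have "k n \<in> {-1, 0, 1}"
    using tu[unfolded totally_unimodular_def, rule_format, of r n c] r(1,2) inj k(1) by simp
  then have unit: "k n * k n = 1" using k(1) r(3) by auto
  from dep obtain d where d: "\<And>i. i \<in> I \<Longrightarrow> (\<Sum>x\<in>insert e X. d x * G i x) = 0"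
    and nz: "\<exists>x\<in>insert e X. d x \<noteq> 0"
    unfolding independent_columns_def by blast
  \<comment> \<open>The values of \<open>d\<close> at the edges \<open>c b\<close> form a nonzero
    kernel vector of the bordered matrix for every \<open>i\<close> in \<open>I\<close>, including
    rows already chosen by \<open>r\<close>. So its determinant vanishes.\<close>
  have zero: "(\<Sum>b<Suc n. k b * G i (c b)) = 0" if i: "i \<in> I" for i
  proof -
    let ?M = "mat (Suc n) (Suc n) (\<lambda>(a, b). G ((r(n := i)) a) (c b))"
    let ?v = "Matrix.vec (Suc n) (\<lambda>b. d (c b))"
    have rI: "(r(n := i)) a \<in> I" if "a < Suc n" for a
      using that r(1) i by (auto simp: less_Suc_eq)
    have "?M *\<^sub>v ?v = 0\<^sub>v (Suc n)"
    proof (rule eq_vecI)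
      fix a assume "a < dim_vec (0\<^sub>v (Suc n))"
      then have a: "a < Suc n" by simp
      have "vec_index (?M *\<^sub>v ?v) a = (\<Sum>b<Suc n. d (c b) * G ((r(n := i)) a) (c b))"
        using a by (simp add: scalar_prod_def lessThan_atLeast0 mult.commute del: sum.op_ivl_Suc)
      also have "\<dots> = (\<Sum>x\<in>insert e X. d x * G ((r(n := i)) a) x)"
        using sum.reindex[OF inj', of "\<lambda>x. d x * G ((r(n := i)) a) x"] by (simp add: im' del: sum.lessThan_Suc)
      also have "\<dots> = 0" using d[OF rI[OF a]] .
      finally show "vec_index (?M *\<^sub>v ?v) a = vec_index (0\<^sub>v (Suc n)) a" using a by simp
    qed simp
    moreover have "?v \<noteq> 0\<^sub>v (Suc n)"
    proof
      assume v: "?v = 0\<^sub>v (Suc n)"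
      have "d (c b) = 0" if "b < Suc n" for b
        using arg_cong[OF v, of "\<lambda>v. vec_index v b"] that by simp
      with nz im' show False by (metis imageE lessThan_iff)
    qed
    moreover have "?v \<in> carrier_vec (Suc n)" by simp
    ultimately have "det ?M = 0"
      using det_0_iff_vec_prod_zero[of ?M "Suc n"] by (metis mat_carrier)
    with k(2)[of i] show ?thesis by simp
  qed
  have "G i e = (\<Sum>x\<in>X. (- k n * k (inv_into {..<n} c x)) * G i x)" if "i \<in> I" for i
  proof -
    have "(\<Sum>x\<in>X. (- k n * k (inv_into {..<n} c x)) * G i x) = (\<Sum>b<n. - k n * k b * G i (c b))"
      unfolding im[symmetric] using inj by (subst sum.reindex) auto
    also have "\<dots> = - k n * (\<Sum>b<n. k b * G i (c b))"
      by (simp add: sum_distrib_left mult.assoc)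
    also have "(\<Sum>b<n. k b * G i (c b)) = - k n * G i e"
      using zero[OF that] ce by simp
    finally show ?thesis using unit by (simp flip: mult.assoc)
  qed
  then show "\<exists>c. \<forall>i\<in>I. G i e = (\<Sum>x\<in>X. c x * G i x)"
    by (intro exI[of _ "\<lambda>x. - k n * k (inv_into {..<n} c x)"]) simp
qed

section \<open>Vertex-edge matrices\<close>

text \<open>If some column has at most one nonzero entry, expand along it and use induction.
  Otherwise each column has exactly one 1 and one -1, so the rows add up to zero. Ends outside the
  image of \<open>v\<close> are allowed because a submatrix may omit vertices.\<close>

lemma det_incidence:
  assumes "inj_on v {..<n}"
  shows "det (mat n n (\<lambda>(a, b). of_bool (h b = v a) - of_bool (t b = v a))) \<in> {-1, 0, 1 :: int}"
  using assms
proof (induction n arbitrary: v h t)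
  case 0
  then show ?case by simp
next
  case (Suc n)
  let ?f = "\<lambda>a b. of_bool (h b = v a) - of_bool (t b = v a) :: int"
  let ?M = "mat (Suc n) (Suc n) (\<lambda>(a, b). ?f a b)"
  show ?case
  proof (cases "\<exists>b<Suc n. \<exists>a0<Suc n. \<forall>a<Suc n. a \<noteq> a0 \<longrightarrow> ?f a b = 0")
    case True
    then obtain b a0 where b: "b < Suc n" and a0: "a0 < Suc n"
      "\<And>a. a < Suc n \<Longrightarrow> a \<noteq> a0 \<Longrightarrow> ?f a b = 0" by blast
    have "det ?M = (\<Sum>a<Suc n. ?M $$ (a, b) * cofactor ?M a b)"
      using b by (intro laplace_expansion_column) auto
    also have "\<dots> = ?M $$ (a0, b) * cofactor ?M a0 b"
      using a0 b by (subst sum.remove[of _ a0]) (auto intro!: sum.neutral)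
    finally have det: "det ?M = ?f a0 b * ((-1) ^ (a0 + b) * det (mat_delete ?M a0 b))"
      using a0(1) b by (simp add: cofactor_def)
    let ?s = "\<lambda>i a. if a < i then a else Suc a"
    have "inj_on (\<lambda>a. v (?s a0 a)) {..<n}"
    proof (rule inj_onI)
      fix x y assume xy: "x \<in> {..<n}" "y \<in> {..<n}" "v (?s a0 x) = v (?s a0 y)"
      have "?s a0 x \<in> {..<Suc n}" "?s a0 y \<in> {..<Suc n}" using xy by auto
      with Suc.prems xy(3) have "?s a0 x = ?s a0 y" by (simp only: inj_on_eq_iff)
      then show "x = y" by (auto split: if_splits)
    qed
    from Suc.IH[OF this, of "\<lambda>b'. h (?s b b')" "\<lambda>b'. t (?s b b')"]
    have D: "det (mat_delete ?M a0 b) \<in> {-1, 0, 1}" unfolding mat_delete_mat by simp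
    have F: "?f a0 b \<in> {-1, 0, 1}" by simp
    have "(-1 :: int) ^ (a0 + b) = 1 \<or> (-1 :: int) ^ (a0 + b) = -1" by (cases "even (a0 + b)") auto
    then show ?thesis unfolding det using D F by (elim disjE) auto
  next
    case False
    \<comment> \<open>A column with an end outside the chosen rows has a nonzero entry in one row at
      most, which is the case already excluded.\<close>
    have ends: "h b \<in> v ` {..<Suc n} \<and> t b \<in> v ` {..<Suc n}" if b: "b < Suc n" for b
    proof (rule ccontr)
      assume notin: "\<not> ?thesis"
      \<comment> \<open>\<open>w\<close> is the only end that can be among the rows, and
        \<open>a0\<close> is its row. If neither end is, the column is zero and the default 0 for
        \<open>a0\<close> works equally well.\<close>
      define w where "w = (if h b \<in> v ` {..<Suc n} then h b else t b)"
      define a0 where "a0 = (if w \<in> v ` {..<Suc n} then inv_into {..<Suc n} v w else 0)"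
      have "a0 < Suc n" unfolding a0_def using inv_into_into[of w v "{..<Suc n}"] by auto
      moreover have "?f a b = 0" if "a < Suc n" "a \<noteq> a0" for a
      proof -
        have "v a \<noteq> w"
        proof
          assume "v a = w"
          then have "inv_into {..<Suc n} v w = a" using Suc.prems that(1) by auto
          moreover have "w \<in> v ` {..<Suc n}" using \<open>v a = w\<close> that(1) by auto
          ultimately show False using that(2) by (simp add: a0_def)
        qed
        moreover have "v a \<in> v ` {..<Suc n}" using that(1) by auto
        ultimately have "h b \<noteq> v a" "t b \<noteq> v a" using notin unfolding w_def by metis+
        then show ?thesis by simp
      qed
      ultimately show False using False b by blast
    qed
    have one: "(\<Sum>a<Suc n. of_bool (x = v a)) = (1::int)" if "x \<in> v ` {..<Suc n}" for x
    proof -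
      from that obtain a0 where a0: "a0 < Suc n" "x = v a0" by auto
      have "(\<Sum>a<Suc n. of_bool (x = v a)) = (\<Sum>a<Suc n. if a = a0 then 1 else (0::int))"
        using a0 Suc.prems by (intro sum.cong refl) (auto simp: inj_on_eq_iff)
      also have "\<dots> = 1" using a0(1) by (simp del: sum.lessThan_Suc)
      finally show ?thesis .
    qed
    \<comment> \<open>The all-ones vector lies in the kernel of the transpose, since each column
      sums to \<open>1 - 1\<close>.\<close>
    let ?v = "Matrix.vec (Suc n) (\<lambda>_. 1 :: int)"
    have "?M\<^sup>T *\<^sub>v ?v = 0\<^sub>v (Suc n)"
    proof (rule eq_vecI)
      fix b assume "b < dim_vec (0\<^sub>v (Suc n))"
      then have b: "b < Suc n" by simp
      have "vec_index (?M\<^sup>T *\<^sub>v ?v) b = (\<Sum>a<Suc n. ?f a b)"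
        using b by (simp add: scalar_prod_def lessThan_atLeast0 del: sum.op_ivl_Suc)
      also have "\<dots> = 0" using one ends[OF b] by (simp add: sum_subtractf del: sum.lessThan_Suc)
      finally show "vec_index (?M\<^sup>T *\<^sub>v ?v) b = vec_index (0\<^sub>v (Suc n)) b" using b by simp
    qed simp
    moreover have "?v \<noteq> 0\<^sub>v (Suc n)"
      by (metis index_vec index_zero_vec(1) zero_less_Suc zero_neq_one)
    moreover have "?v \<in> carrier_vec (Suc n)" by simp
    moreover have "?M\<^sup>T \<in> carrier_mat (Suc n) (Suc n)" by simp
    ultimately have "det (?M\<^sup>T) = 0" using det_0_iff_vec_prod_zero by blast
    moreover have "det (?M\<^sup>T) = det ?M" by (rule det_transpose[of _ "Suc n"]) simp
    ultimately show ?thesis by simp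
  qed
qed

lemma totally_unimodular_vertex_edge_matrix:
  fixes G :: "'i \<Rightarrow> 'e \<Rightarrow> int"
  assumes "vertex_edge_matrix D I E G"
  shows "totally_unimodular I E G"
  unfolding totally_unimodular_def
proof (intro allI impI, elim conjE)
  fix n and r :: "nat \<Rightarrow> 'i" and c :: "nat \<Rightarrow> 'e"
  assume r: "r ` {..<n} \<subseteq> I" "inj_on r {..<n}" and c: "c ` {..<n} \<subseteq> E" "inj_on c {..<n}"
  from assms obtain v where v: "bij_betw v I (verts D)"
    and G: "\<forall>i\<in>I. \<forall>e\<in>E. G i e = of_bool (head D e = v i) - of_bool (tail D e = v i)"
    unfolding vertex_edge_matrix_def by blast
  have "inj_on (v \<circ> r) {..<n}"
    using r v by (auto simp: bij_betw_def intro!: comp_inj_on inj_on_subset[of v I])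
  then have "inj_on (\<lambda>a. v (r a)) {..<n}" by (simp add: comp_def)
  from det_incidence[OF this, of "\<lambda>b. head D (c b)" "\<lambda>b. tail D (c b)"]
  have "det (mat n n (\<lambda>(a, b). of_bool (head D (c b) = v (r a)) - of_bool (tail D (c b) = v (r a))))
      \<in> {-1, 0, 1 :: int}" .
  also have "mat n n (\<lambda>(a, b). of_bool (head D (c b) = v (r a)) - of_bool (tail D (c b) = v (r a)))
      = mat n n (\<lambda>(a, b). G (r a) (c b))"
    using G r(1) c(1) by (intro eq_matI) (auto simp: image_subset_iff)
  finally show "det (mat n n (\<lambda>(a, b). G (r a) (c b))) \<in> {-1, 0, 1}" .
qed

section \<open>Cycles, tensions and cycle-edge matrices\<close>

lemma sum_of_bool_mult:
  fixes f :: "'e \<Rightarrow> 'k::comm_ring_1"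
  assumes "finite E" "S \<subseteq> E"
  shows "(\<Sum>e\<in>E. f e * of_bool (e \<in> S)) = (\<Sum>e\<in>S. f e)"
proof -
  have "(\<Sum>e\<in>E. f e * of_bool (e \<in> S)) = (\<Sum>e\<in>E. if e \<in> S then f e else 0)"
    by (intro sum.cong) auto
  with assms show ?thesis by (simp add: sum.If_cases Int_absorb1)
qed

lemma cas_telescope:
  fixes \<pi> :: "'v \<Rightarrow> 'k::ab_group_add"
  assumes "pre_digraph.cas D u p v"
  shows "(\<Sum>a\<leftarrow>p. \<pi> (head D a) - \<pi> (tail D a)) = \<pi> v - \<pi> u"
  using assms
proof (induction p arbitrary: u)
  case Nil
  then show ?case by (simp add: pre_digraph.cas.simps)
next
  case (Cons a p)
  then have "tail D a = u" "pre_digraph.cas D (head D a) p v"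
    by (simp_all add: pre_digraph.cas.simps)
  with Cons.IH[of "head D a"] show ?case by (simp add: algebra_simps)
qed

text \<open>Orthogonality of tensions and cycles. Traversing an edge backwards changes the sign of
  its potential difference, so the sum is that of the potential differences along a closed walk,
  which telescopes to zero.\<close>

lemma undirected_cycle_tension:
  fixes \<pi> :: "'v \<Rightarrow> int"
  assumes cyc: "undirected_cycle D p" and fin: "finite (arcs D)"
  shows "(\<Sum>e\<in>arcs D. (\<pi> (head D e) - \<pi> (tail D e)) *
    (of_bool ((e, True) \<in> set p) - of_bool ((e, False) \<in> set p))) = 0"
proof -
  let ?B = "both_directions D"
  let ?t = "\<lambda>e. \<pi> (head D e) - \<pi> (tail D e)"
  have d: "distinct (map fst p)" using cyc by (simp add: undirected_cycle_def)
  then have dp: "distinct p" by (simp add: distinct_map)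
  obtain u where u: "pre_digraph.cas ?B u p u" "set p \<subseteq> arcs D \<times> UNIV"
    using cyc unfolding undirected_cycle_def pre_digraph.cycle_def pre_digraph.awalk_def
    by (auto simp: both_directions_def)
  have "(\<Sum>e\<in>arcs D. ?t e * (of_bool ((e, True) \<in> set p) - of_bool ((e, False) \<in> set p)))
    = (\<Sum>e\<in>arcs D. \<Sum>b\<in>UNIV. (if b then ?t e else - ?t e) * of_bool ((e, b) \<in> set p))"
    by (intro sum.cong refl) (simp add: UNIV_bool algebra_simps)
  also have "\<dots> = (\<Sum>a\<in>arcs D \<times> UNIV. (if snd a then ?t (fst a) else - ?t (fst a)) * of_bool (a \<in> set p))"
    by (subst sum.cartesian_product) (simp add: case_prod_unfold)
  also have "\<dots> = (\<Sum>a\<in>set p. if snd a then ?t (fst a) else - ?t (fst a))"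
    using fin u(2) by (intro sum_of_bool_mult) auto
  also have "\<dots> = (\<Sum>a\<in>set p. \<pi> (head ?B a) - \<pi> (tail ?B a))"
    by (intro sum.cong refl) (auto simp: both_directions_def)
  also have "\<dots> = (\<Sum>a\<leftarrow>p. \<pi> (head ?B a) - \<pi> (tail ?B a))"
    using dp by (rule sum_list_distinct_conv_sum_set[symmetric])
  also have "\<dots> = 0" using cas_telescope[OF u(1), of \<pi>] by simp
  finally show ?thesis .
qed

text \<open>If the first edge were used again, in either direction, the walk would come back to its
  first vertex \<open>u\<close>. This supplies the second condition of
  \<open>undirected_cycle\<close> for a cycle closed up from a path.\<close>

lemma distinct_edges_of_apath:
  assumes "pre_digraph.cas (both_directions D) u p v"
    "distinct (pre_digraph.awalk_verts (both_directions D) u p)"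
  shows "distinct (map fst p)"
  using assms
proof (induction p arbitrary: u)
  case (Cons a p)
  let ?B = "both_directions D"
  interpret pre_digraph ?B .
  have ends: "tail ?B b \<in> set (awalk_verts w q) \<and> head ?B b \<in> set (awalk_verts w q)"
    if "b \<in> set q" "cas w q v" for b w q
    using that by (induction q arbitrary: w) (auto, (metis awalk_verts.simps cas.elims(2) list.set_intros(1))+)
  have a: "tail ?B a = u" "cas (head ?B a) p v"
    using Cons.prems(1) by auto
  have dist: "u \<notin> set (awalk_verts (head ?B a) p)" "distinct (awalk_verts (head ?B a) p)"
    using Cons.prems(2) a by auto
  have "fst a \<notin> fst ` set p"
  proof
    assume "fst a \<in> fst ` set p"
    then obtain b where b: "b \<in> set p" "fst b = fst a" by auto
    have "u \<in> {tail ?B b, head ?B b}"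
      using a(1) b(2) unfolding both_directions_def by (cases a; cases b) auto
    with ends[OF b(1) a(2)] dist(1) show False by auto
  qed
  with Cons.IH[OF a(2) dist(2)] show ?case by simp
qed simp

text \<open>The vertices \<open>S\<close> reachable from the head of \<open>e\<close> without using \<open>X\<close> or \<open>e\<close> define a cut whose
  edges lie in \<open>insert e X\<close>. It contains \<open>e\<close>, since a path back to the tail of \<open>e\<close> would close a
  cycle avoiding \<open>X\<close>. Cuts are orthogonal to cycles, so this one is the required relation.\<close>

lemma ring_closed_columns_cycle_edge:
  fixes G :: "'i \<Rightarrow> 'e \<Rightarrow> int"
  assumes "cycle_edge_matrix D I E G"
  shows "ring_closed_columns I E G"
  unfolding ring_closed_columns_def
proof (intro allI impI, elim conjE)
  fix X e assume X: "X \<subseteq> E" "independent_columns I G X" and e: "e \<in> E - X"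
    and dep: "\<not> independent_columns I G (insert e X)"
  from assms obtain p where fd: "fin_digraph D" and arcs: "arcs D = E"
    and p: "\<And>i. i \<in> I \<Longrightarrow> undirected_cycle D (p i)"
    and bij: "bij_betw (\<lambda>i. fst ` set (p i)) I {fst ` set c | c. undirected_cycle D c}"
    and G: "\<And>i e. i \<in> I \<Longrightarrow> e \<in> E \<Longrightarrow>
      G i e = of_bool ((e, True) \<in> set (p i)) - of_bool ((e, False) \<in> set (p i))"
    unfolding cycle_edge_matrix_def by blast
  interpret fin_digraph D by fact
  have finE: "finite E" using arcs finite_arcs by simp
  have finX: "finite X" using X(1) finE finite_subset by blast
  \<comment> \<open>Only the edges outside \<open>insert e X\<close> remain in \<open>D'\<close>,
    where reachability will define \<open>S\<close>. By \<open>cas_eq\<close> and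
    \<open>verts_eq\<close> its walks are also walks of \<open>D\<close> through the same
    vertices.\<close>
  define D' where "D' = D\<lparr>arcs := E - insert e X\<rparr>"
  let ?B = "both_directions D" and ?B' = "both_directions D'"
  have B'_simps: "verts ?B' = verts D" "arcs ?B' = (E - insert e X) \<times> UNIV"
      "tail ?B' = tail ?B" "head ?B' = head ?B"
    by (auto simp: D'_def both_directions_def)
  have B_simps: "verts ?B = verts D" "arcs ?B = E \<times> UNIV"
    by (auto simp: both_directions_def arcs)
  have wf_ends: "head D f \<in> verts D" "tail D f \<in> verts D" if "f \<in> E" for f
    using that arcs by auto
  interpret B': wf_digraph ?B'
    by unfold_locales (use wf_ends in \<open>auto simp: D'_def both_directions_def split: if_splits\<close>)
  have cas_eq: "pre_digraph.cas ?B' u q w = pre_digraph.cas ?B u q w" for u q w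
    by (induction q arbitrary: u) (simp_all add: pre_digraph.cas.simps B'_simps)
  have verts_eq: "pre_digraph.awalk_verts ?B' u q = pre_digraph.awalk_verts ?B u q" for u q
    by (induction q arbitrary: u) (simp_all add: pre_digraph.awalk_verts.simps B'_simps)
  define S where "S = {w. \<exists>q. B'.awalk (head D e) q w}"
  have head_S: "head D e \<in> S"
    unfolding S_def using e wf_ends(1)[of e] B'_simps(1) by (auto simp: B'.awalk_Nil_iff intro!: exI[of _ "[]"])
  have step: "head ?B a \<in> S" if "tail ?B a \<in> S" "a \<in> (E - insert e X) \<times> UNIV" for a
  proof -
    from that(1) obtain q where q: "B'.awalk (head D e) q (tail ?B a)" unfolding S_def by blast
    have "B'.awalk (tail ?B a) [a] (head ?B a)"
      using B'.arc_implies_awalk[of a] that(2) B'_simps by simp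
    with q have "B'.awalk (head D e) (q @ [a]) (head ?B a)" by (rule B'.awalk_appendI)
    then show ?thesis unfolding S_def by blast
  qed
  have closed: "head D f \<in> S \<longleftrightarrow> tail D f \<in> S" if "f \<in> E - insert e X" for f
    using step[of "(f, True)"] step[of "(f, False)"] that by (auto simp: both_directions_def)
  from dep obtain d where d: "\<And>i. i \<in> I \<Longrightarrow> (\<Sum>x\<in>insert e X. d x * G i x) = 0"
    and nz: "\<exists>x\<in>insert e X. d x \<noteq> 0"
    unfolding independent_columns_def by blast
  have de: "d e \<noteq> 0"
  proof
    assume 0: "d e = 0"
    have "(\<Sum>x\<in>X. d x * G i x) = 0" if "i \<in> I" for i
      using d[OF that] 0 finX e by simp
    from independent_columnsD[OF X(2) this] 0 nz show False by auto
  qed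
  have tail_S: "tail D e \<notin> S"
  proof
    assume "tail D e \<in> S"
    then obtain q0 where "B'.awalk (head D e) q0 (tail D e)" unfolding S_def by blast
    then obtain q where q: "B'.apath (head D e) q (tail D e)"
      using B'.apath_awalk_to_apath by blast
    let ?c = "(e, True) # q"
    have qE: "set q \<subseteq> (E - insert e X) \<times> UNIV" and qcas: "pre_digraph.cas ?B (head D e) q (tail D e)"
      and qd: "distinct (pre_digraph.awalk_verts ?B (head D e) q)"
      using q unfolding pre_digraph.apath_def pre_digraph.awalk_def
      by (auto simp: B'_simps cas_eq verts_eq)
    have "pre_digraph.awalk ?B (tail D e) ?c (tail D e)"
      unfolding pre_digraph.awalk_def
      using qE qcas e wf_ends[of e]
      by (auto simp: B_simps pre_digraph.cas.simps) (auto simp: both_directions_def)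
    moreover have "tl (pre_digraph.awalk_verts ?B (tail D e) ?c) = pre_digraph.awalk_verts ?B (head D e) q"
      by (simp add: pre_digraph.awalk_verts.simps) (simp add: both_directions_def)
    ultimately have "pre_digraph.cycle ?B ?c"
      unfolding pre_digraph.cycle_def using qd by auto
    moreover have "distinct (map fst ?c)"
      using distinct_edges_of_apath[OF qcas qd] qE by auto
    ultimately have "undirected_cycle D ?c" by (simp add: undirected_cycle_def)
    \<comment> \<open>There is one row per edge set of a cycle, so some row \<open>i\<close> belongs
      to the edge set of \<open>?c\<close>, possibly with another starting point or direction of
      traversal.\<close>
    then have "fst ` set ?c \<in> (\<lambda>i. fst ` set (p i)) ` I"
      using bij unfolding bij_betw_def by blast
    then obtain i where i: "i \<in> I" "fst ` set (p i) = fst ` set ?c" by auto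
    \<comment> \<open>Row \<open>i\<close> vanishes on \<open>X\<close>, so the relation
      \<open>d\<close> reduces to \<open>d e * G i e = 0\<close>. But the cycle passes
      \<open>e\<close> in exactly one direction, so \<open>G i e\<close> is 1 or -1.\<close>
    have "G i x = 0" if "x \<in> X" for x
    proof -
      have "x \<notin> fst ` set (p i)" using that e qE unfolding i(2) by auto
      then have "(x, b) \<notin> set (p i)" for b by force
      then show ?thesis using G[OF i(1)] that X(1) by auto
    qed
    then have "d e * G i e = 0" using d[OF i(1)] finX e by simp
    with de have Ge: "G i e = 0" by simp
    have "e \<in> fst ` set (p i)" unfolding i(2) by simp
    then obtain b where b: "(e, b) \<in> set (p i)" by auto
    have "distinct (map fst (p i))" using p[OF i(1)] by (simp add: undirected_cycle_def)
    then have "inj_on fst (set (p i))" by (simp add: distinct_map)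
    then have "(e, \<not> b) \<notin> set (p i)" using b by (auto dest: inj_onD[of _ _ "(e, b)" "(e, \<not> b)"])
    with b G[OF i(1), of e] e Ge show False by (cases b) auto
  qed
  \<comment> \<open>With the indicator of \<open>S\<close> as potential, \<open>?x\<close> is the
    signed cut of \<open>S\<close>: it is 1 at \<open>e\<close> and 0 outside
    \<open>insert e X\<close>.\<close>
  define \<pi> where "\<pi> w = (of_bool (w \<in> S) :: int)" for w
  let ?x = "\<lambda>f. \<pi> (head D f) - \<pi> (tail D f)"
  have xe: "?x e = 1" using head_S tail_S by (simp add: \<pi>_def)
  have x0: "?x f = 0" if "f \<in> E - insert e X" for f
    using closed[OF that] by (simp add: \<pi>_def)
  have "G i e = (\<Sum>f\<in>X. - ?x f * G i f)" if i: "i \<in> I" for i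
  proof -
    have "0 = (\<Sum>f\<in>E. ?x f * G i f)"
      using undirected_cycle_tension[OF p[OF i], of \<pi>] finE G[OF i] by (simp add: arcs cong: sum.cong)
    also have "\<dots> = (\<Sum>f\<in>insert e X. ?x f * G i f)"
      using x0 X(1) e finE by (intro sum.mono_neutral_right) auto
    also have "\<dots> = G i e + (\<Sum>f\<in>X. ?x f * G i f)" using xe finX e by simp
    finally show ?thesis by (simp only: mult_minus_left sum_negf)
  qed
  then show "\<exists>c. \<forall>i\<in>I. G i e = (\<Sum>f\<in>X. c f * G i f)"
    by (intro exI[of _ "\<lambda>f. - ?x f"]) simp
qed

section \<open>Pairs of functions and the rank polynomial\<close>

text \<open>The power of \<omega> depends only on the exponent modulo \<open>\<sigma>\<close>, so
  the residue classes can be merged into one sum.\<close>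

lemma root_sum_eq_sum_pairs:
  fixes flow :: "('e \<Rightarrow> 'a::{ab_group_add,finite}) \<Rightarrow> bool"
  assumes "\<omega> ^ \<sigma> = 1" "\<sigma> > 0" "finite E"
  shows "root_sum \<sigma> \<omega> E flow opr =
    (\<Sum>(f, g)\<in>{(f, g). f \<in> E \<rightarrow>\<^sub>E UNIV \<and> g \<in> E \<rightarrow>\<^sub>E UNIV \<and> flow (\<lambda>e. f e - g e)}.
      \<omega> ^ card (opr (supp E f) (supp E g)))"
proof -
  define P where "P = {(f, g). f \<in> E \<rightarrow>\<^sub>E UNIV \<and> g \<in> E \<rightarrow>\<^sub>E UNIV \<and> flow (\<lambda>e. f e - g e)}"
  define n where "n = (\<lambda>(f :: 'e \<Rightarrow> 'a, g :: 'e \<Rightarrow> 'a). card (opr (supp E f) (supp E g)))"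
  have "finite (E \<rightarrow>\<^sub>E (UNIV :: 'a set))" using assms(3) by (simp add: finite_PiE)
  then have "finite ((E \<rightarrow>\<^sub>E (UNIV :: 'a set)) \<times> (E \<rightarrow>\<^sub>E (UNIV :: 'a set)))" by blast
  then have fin: "finite P" by (rule finite_subset[rotated]) (auto simp: P_def)
  have pow: "\<omega> ^ (m mod \<sigma>) = \<omega> ^ m" for m
  proof -
    have "\<omega> ^ m = \<omega> ^ (\<sigma> * (m div \<sigma>) + m mod \<sigma>)" by simp
    also have "\<dots> = \<omega> ^ (m mod \<sigma>)" unfolding power_add power_mult assms(1) by simp
    finally show ?thesis by simp
  qed
  have "\<omega> ^ k * of_nat (card (flow_pairs E flow opr k \<sigma>)) = (\<Sum>x\<in>{x\<in>P. n x mod \<sigma> = k}. \<omega> ^ n x)"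
    if "k < \<sigma>" for k
  proof -
    have "flow_pairs E flow opr k \<sigma> = {x\<in>P. n x mod \<sigma> = k}"
      using that unfolding flow_pairs_def P_def n_def by (auto simp: cong_def)
    moreover have "(\<Sum>x\<in>{x\<in>P. n x mod \<sigma> = k}. \<omega> ^ n x) = (\<Sum>x\<in>{x\<in>P. n x mod \<sigma> = k}. \<omega> ^ k)"
      using pow by (intro sum.cong) auto
    ultimately show ?thesis by (simp add: mult.commute)
  qed
  then have "root_sum \<sigma> \<omega> E flow opr = (\<Sum>k\<in>{..<\<sigma>}. \<Sum>x\<in>{x\<in>P. n x mod \<sigma> = k}. \<omega> ^ n x)"
    unfolding root_sum_def by (intro sum.cong) auto
  also have "\<dots> = (\<Sum>x\<in>P. \<omega> ^ n x)"
    using fin assms(2) by (intro sum.group) auto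
  finally show ?thesis unfolding P_def n_def by (simp add: case_prod_unfold)
qed

text \<open>Substitute \<open>h = f - g\<close>. For fixed \<open>h\<close> the values of
  \<open>g\<close> are chosen independently at each edge, so the sum over \<open>g\<close> of the
  product is a product of sums. The invariance under \<open>restrict\<close> is needed because the
  functions are extensional on \<open>E\<close>.\<close>

lemma sum_pairs_eq_sum_flows:
  fixes flow :: "('e \<Rightarrow> 'a::{ab_group_add,finite}) \<Rightarrow> bool" and w :: "'a \<Rightarrow> 'a \<Rightarrow> 'c::comm_semiring_1"
  assumes fin: "finite E" and cong: "\<And>h. flow (restrict h E) \<longleftrightarrow> flow h"
  shows "(\<Sum>(f, g)\<in>{(f, g). f \<in> E \<rightarrow>\<^sub>E UNIV \<and> g \<in> E \<rightarrow>\<^sub>E UNIV \<and> flow (\<lambda>e. f e - g e)}.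
      \<Prod>e\<in>E. w (f e) (g e))
    = (\<Sum>h\<in>{h \<in> E \<rightarrow>\<^sub>E UNIV. flow h}. \<Prod>e\<in>E. \<Sum>b\<in>UNIV. w (h e + b) b)"
proof -
  let ?P = "{(f, g). f \<in> E \<rightarrow>\<^sub>E UNIV \<and> g \<in> E \<rightarrow>\<^sub>E (UNIV :: 'a set) \<and> flow (\<lambda>e. f e - g e)}"
  let ?F = "{h \<in> E \<rightarrow>\<^sub>E UNIV. flow h}"
  have ext: "(\<lambda>e\<in>E. h e + g e - g e) = h" if "h \<in> E \<rightarrow>\<^sub>E UNIV" for h g :: "'e \<Rightarrow> 'a"
    using that by (auto simp: fun_eq_iff PiE_def extensional_def)
  have sub: "flow (\<lambda>e. (\<lambda>e\<in>E. h e + g e) e - g e) \<longleftrightarrow> flow h" if "h \<in> E \<rightarrow>\<^sub>E UNIV" for h g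
  proof -
    have "restrict (\<lambda>e. (\<lambda>e\<in>E. h e + g e) e - g e) E = h"
      using that by (auto simp: fun_eq_iff PiE_def extensional_def)
    then show ?thesis using cong by metis
  qed
  have "(\<Sum>(f, g)\<in>?P. \<Prod>e\<in>E. w (f e) (g e)) = (\<Sum>(h, g)\<in>?F \<times> (E \<rightarrow>\<^sub>E UNIV). \<Prod>e\<in>E. w (h e + g e) (g e))"
  proof (rule sum.reindex_bij_witness[where
        i = "\<lambda>(h, g). (\<lambda>e\<in>E. h e + g e, g)" and j = "\<lambda>(f, g). (\<lambda>e\<in>E. f e - g e, g)"])
    fix x assume "x \<in> ?P"
    then obtain f g where x: "x = (f, g)" "f \<in> E \<rightarrow>\<^sub>E UNIV" "g \<in> E \<rightarrow>\<^sub>E UNIV" "flow (\<lambda>e. f e - g e)"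
      by auto
    show "(case case x of (f, g) \<Rightarrow> (\<lambda>e\<in>E. f e - g e, g) of (h, g) \<Rightarrow> (\<lambda>e\<in>E. h e + g e, g)) = x"
      using x(2) unfolding x(1) by (auto simp: fun_eq_iff PiE_def extensional_def)
    show "(case x of (f, g) \<Rightarrow> (\<lambda>e\<in>E. f e - g e, g)) \<in> ?F \<times> (E \<rightarrow>\<^sub>E UNIV)"
      using x(3,4) cong unfolding x(1) by (simp add: restrict_PiE_iff)
    show "(case case x of (f, g) \<Rightarrow> (\<lambda>e\<in>E. f e - g e, g) of
        (h, g) \<Rightarrow> \<Prod>e\<in>E. w (h e + g e) (g e)) = (case x of (f, g) \<Rightarrow> \<Prod>e\<in>E. w (f e) (g e))"
      unfolding x(1) by simp
  next
    fix x assume "x \<in> ?F \<times> (E \<rightarrow>\<^sub>E (UNIV :: 'a set))"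
    then obtain h g where x: "x = (h, g)" "h \<in> E \<rightarrow>\<^sub>E UNIV" "flow h" "g \<in> E \<rightarrow>\<^sub>E UNIV" by auto
    show "(case case x of (h, g) \<Rightarrow> (\<lambda>e\<in>E. h e + g e, g) of (f, g) \<Rightarrow> (\<lambda>e\<in>E. f e - g e, g)) = x"
      using x(2) unfolding x(1) by (auto simp: fun_eq_iff PiE_def extensional_def)
    show "(case x of (h, g) \<Rightarrow> (\<lambda>e\<in>E. h e + g e, g)) \<in> ?P"
      using x(3,4) sub[OF x(2)] unfolding x(1) by (simp add: restrict_PiE_iff)
  qed
  also have "\<dots> = (\<Sum>h\<in>?F. \<Sum>g\<in>E \<rightarrow>\<^sub>E UNIV. \<Prod>e\<in>E. w (h e + g e) (g e))"
    by (rule sum.cartesian_product[symmetric])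
  also have "\<dots> = (\<Sum>h\<in>?F. \<Prod>e\<in>E. \<Sum>b\<in>UNIV. w (h e + b) b)"
    using fin by (intro sum.cong refl prod_sum_PiE[symmetric]) auto
  finally show ?thesis .
qed

text \<open>Only \<open>b = 0\<close> and \<open>b = - a\<close> make one of the two arguments
  vanish. They coincide when \<open>a = 0\<close>; otherwise the group has at least two elements and
  \<open>CARD('a) - 2\<close> of them are left.\<close>

lemma sum_translated_pair_weights:
  fixes a :: "'a::{ab_group_add,finite}" and p :: "bool \<Rightarrow> bool \<Rightarrow> 'c::comm_ring_1"
  shows "(\<Sum>b\<in>UNIV. p (a + b \<noteq> 0) (b \<noteq> 0)) =
    (if a = 0 then p False False + (of_nat CARD('a) - 1) * p True True
     else p True False + p False True + (of_nat CARD('a) - 2) * p True True)"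
proof (cases "a = 0")
  case True
  have "(\<Sum>b\<in>UNIV. p (a + b \<noteq> 0) (b \<noteq> 0)) = p False False + (\<Sum>b\<in>UNIV - {0 :: 'a}. p True True)"
    using True by (subst sum.remove[of _ 0]) (auto intro!: sum.cong)
  also have "(\<Sum>b\<in>UNIV - {0 :: 'a}. p True True) = of_nat (CARD('a) - 1) * p True True"
    by (simp add: card_Diff_singleton)
  also have "of_nat (CARD('a) - 1) = (of_nat CARD('a) - 1 :: 'c)"
    by (simp add: of_nat_diff Suc_leI)
  finally show ?thesis using True by simp
next
  case False
  have two: "card {0, - a} = 2" using False by simp
  then have "2 \<le> CARD('a)" using card_mono[of UNIV "{0, - a}"] by simp
  have neg: "a + b \<noteq> 0" if "b \<noteq> - a" for b
    using that by (metis add.inverse_unique)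
  have "(\<Sum>b\<in>UNIV. p (a + b \<noteq> 0) (b \<noteq> 0)) = (\<Sum>b\<in>{0, - a}. p (a + b \<noteq> 0) (b \<noteq> 0))
      + (\<Sum>b\<in>UNIV - {0, - a}. p (a + b \<noteq> 0) (b \<noteq> 0))"
    by (subst sum.subset_diff[of "{0, - a}"]) (auto simp: add.commute)
  also have "(\<Sum>b\<in>{0, - a}. p (a + b \<noteq> 0) (b \<noteq> 0)) = p True False + p False True"
    using False by simp
  also have "(\<Sum>b\<in>UNIV - {0, - a}. p (a + b \<noteq> 0) (b \<noteq> 0)) = (\<Sum>b\<in>UNIV - {0, - a}. p True True)"
    using neg by (intro sum.cong) auto
  also have "\<dots> = of_nat (CARD('a) - 2) * p True True"
    using two by (simp add: card_Diff_subset)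
  also have "of_nat (CARD('a) - 2) = (of_nat CARD('a) - 2 :: 'c)"
    using \<open>2 \<le> CARD('a)\<close> by (simp add: of_nat_diff)
  finally show ?thesis using False by simp
qed

text \<open>Write \<open>w\<^sub>0\<close> as \<open>(w\<^sub>0 - w\<^sub>1) + w\<^sub>1\<close> and
  expand the product. \<open>B\<close> collects the edges where the first summand is taken; its term
  survives only for functions vanishing on \<open>B\<close>.\<close>

lemma sum_flows_eq_sum_subsets:
  fixes F :: "('e \<Rightarrow> 'a::zero) set" and w\<^sub>0 w\<^sub>1 :: "'c::comm_ring_1"
  assumes "finite E" "finite F"
  shows "(\<Sum>h\<in>F. \<Prod>e\<in>E. if h e = 0 then w\<^sub>0 else w\<^sub>1)
    = (\<Sum>B\<in>Pow E. (w\<^sub>0 - w\<^sub>1) ^ card B * w\<^sub>1 ^ (card E - card B) * of_nat (card {h\<in>F. \<forall>e\<in>B. h e = 0}))"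
proof -
  have "(\<Prod>e\<in>E. if h e = 0 then w\<^sub>0 else w\<^sub>1) =
      (\<Sum>B\<in>Pow E. (w\<^sub>0 - w\<^sub>1) ^ card B * w\<^sub>1 ^ (card E - card B) * of_bool (\<forall>e\<in>B. h e = 0))" for h :: "'e \<Rightarrow> 'a"
  proof -
    have "(\<Prod>e\<in>E. if h e = 0 then w\<^sub>0 else w\<^sub>1) = (\<Prod>e\<in>E. (if h e = 0 then w\<^sub>0 - w\<^sub>1 else 0) + w\<^sub>1)"
      by (intro prod.cong) auto
    also have "\<dots> = (\<Sum>B\<in>Pow E. (\<Prod>e\<in>B. if h e = 0 then w\<^sub>0 - w\<^sub>1 else 0) * (\<Prod>e\<in>E-B. w\<^sub>1))"
      using assms(1) by (rule prod_add)
    also have "\<dots> = (\<Sum>B\<in>Pow E. (w\<^sub>0 - w\<^sub>1) ^ card B * w\<^sub>1 ^ (card E - card B) * of_bool (\<forall>e\<in>B. h e = 0))"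
    proof (intro sum.cong refl)
      fix B assume "B \<in> Pow E"
      then have B: "finite B" "B \<subseteq> E" using assms(1) finite_subset by auto
      have "(\<Prod>e\<in>B. if h e = 0 then w\<^sub>0 - w\<^sub>1 else 0) = (w\<^sub>0 - w\<^sub>1) ^ card B * of_bool (\<forall>e\<in>B. h e = 0)"
      proof (cases "\<forall>e\<in>B. h e = 0")
        case True
        then show ?thesis by simp
      next
        case False
        then have "(\<Prod>e\<in>B. if h e = 0 then w\<^sub>0 - w\<^sub>1 else 0) = 0"
          using B(1) by (intro prod_zero) auto
        moreover have "of_bool (\<forall>e\<in>B. h e = 0) = (0 :: 'c)"
          using False by (simp only: of_bool_eq_0_iff not_False_eq_True)
        ultimately show ?thesis by (simp only: mult_zero_right)
      qed
      with B show "(\<Prod>e\<in>B. if h e = 0 then w\<^sub>0 - w\<^sub>1 else 0) * (\<Prod>e\<in>E-B. w\<^sub>1) =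
          (w\<^sub>0 - w\<^sub>1) ^ card B * w\<^sub>1 ^ (card E - card B) * of_bool (\<forall>e\<in>B. h e = 0)"
        by (simp add: card_Diff_subset mult_ac)
    qed
    finally show ?thesis .
  qed
  then have "(\<Sum>h\<in>F. \<Prod>e\<in>E. if h e = 0 then w\<^sub>0 else w\<^sub>1) = (\<Sum>B\<in>Pow E. \<Sum>h\<in>F.
      (w\<^sub>0 - w\<^sub>1) ^ card B * w\<^sub>1 ^ (card E - card B) * of_bool (\<forall>e\<in>B. h e = 0))"
    by (simp add: sum.swap[of _ F])
  also have "\<dots> = (\<Sum>B\<in>Pow E. (w\<^sub>0 - w\<^sub>1) ^ card B * w\<^sub>1 ^ (card E - card B) * of_nat (card {h\<in>F. \<forall>e\<in>B. h e = 0}))"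
  proof (intro sum.cong refl)
    fix B
    have "(\<Sum>h\<in>F. of_bool (\<forall>e\<in>B. h e = 0)) = (of_nat (card {h\<in>F. \<forall>e\<in>B. h e = 0}) :: 'c)"
      using assms(2) by (simp add: sum.If_cases of_bool_def Int_def)
    then show "(\<Sum>h\<in>F. (w\<^sub>0 - w\<^sub>1) ^ card B * w\<^sub>1 ^ (card E - card B) * of_bool (\<forall>e\<in>B. h e = 0))
      = (w\<^sub>0 - w\<^sub>1) ^ card B * w\<^sub>1 ^ (card E - card B) * of_nat (card {h\<in>F. \<forall>e\<in>B. h e = 0})"
      by (simp only: flip: sum_distrib_left)
  qed
  finally show ?thesis .
qed

section \<open>Rescaling the rank polynomial\<close>

text \<open>With these bounds the natural-number exponents in \<open>rank_polynomial\<close> are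
  true differences.\<close>

lemma matroid_rank_bounds:
  assumes "finite E" "indep {}" "B \<subseteq> E"
  shows "matroid_rank indep B \<le> matroid_rank indep E" "matroid_rank indep B \<le> card B"
proof -
  have finB: "finite B" using assms(1,3) finite_subset by blast
  obtain X where X: "X \<subseteq> B" "indep X" "card X = matroid_rank indep B"
    using matroid_rank_attained[of B indep] finB assms(2) by metis
  obtain Y where "Y \<subseteq> E" "card Y = matroid_rank indep E" "\<And>Z. Z \<subseteq> E \<Longrightarrow> indep Z \<Longrightarrow> card Z \<le> card Y"
    using matroid_rank_attained[of E indep] assms(1,2) by metis
  with X assms(3) show "matroid_rank indep B \<le> matroid_rank indep E" by (metis subset_trans)
  show "matroid_rank indep B \<le> card B" using X card_mono[OF finB] by metis
qed

text \<open>Comparison of exponents, with \<open>r\<close> and \<open>rk\<close> for the ranks of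
  \<open>E\<close> and \<open>B\<close>: for \<open>u\<close> they add up to
  \<open>r - (r - rk) + (card B - rk) = card B\<close>, for \<open>w\<close> to
  \<open>(card E - r) + (r - rk) - (card B - rk) = card E - card B\<close>.\<close>

lemma rank_polynomial_scaled:
  assumes fin: "finite E" "indep {}" and nz: "u \<noteq> 0" "w \<noteq> 0"
  shows "u ^ matroid_rank indep E * w ^ (card E - matroid_rank indep E)
      * rank_polynomial E indep (q * w / u) (u / w)
    = (\<Sum>B\<in>Pow E. u ^ card B * w ^ (card E - card B) * q ^ (matroid_rank indep E - matroid_rank indep B))"
  unfolding rank_polynomial_def sum_distrib_left
proof (intro sum.cong refl)
  fix B assume "B \<in> Pow E"
  then have B: "B \<subseteq> E" by simp
  let ?\<rho> = "matroid_rank indep"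
  obtain k where k: "?\<rho> E = ?\<rho> B + k"
    using le_Suc_ex[OF matroid_rank_bounds(1)[of E indep B, OF fin B]] by blast
  obtain l where l: "card B = ?\<rho> B + l"
    using le_Suc_ex[OF matroid_rank_bounds(2)[of E indep B, OF fin B]] by blast
  obtain m where m: "card E = ?\<rho> E + m"
    using le_Suc_ex[OF matroid_rank_bounds(2)[of E indep E, OF fin subset_refl]] by blast
  \<comment> \<open>The powers of \<open>w\<close> are compared after multiplying by
    \<open>w ^ card B\<close>; the common factor \<open>w\<close> to the rank of \<open>B\<close> is
    then cancelled.\<close>
  have "card B \<le> card E" using fin(1) B by (rule card_mono)
  then have "w ^ (card E - card B) * w ^ card B = w ^ card E"
    by (simp flip: power_add)
  also have "w ^ card B = w ^ l * w ^ ?\<rho> B" by (simp add: l power_add)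
  also have "w ^ card E = w ^ m * w ^ k * w ^ ?\<rho> B" by (simp add: m k power_add)
  finally have "w ^ (card E - card B) * w ^ l = w ^ m * w ^ k"
    using nz(2) by (simp flip: mult.assoc)
  then have w: "w ^ m * w ^ k / w ^ l = w ^ (card E - card B)"
    using nz(2) by (simp add: nonzero_divide_eq_eq)
  have EB: "card E - ?\<rho> E = m" "?\<rho> E - ?\<rho> B = k" "card B - ?\<rho> B = l"
    unfolding m l by (simp_all add: k)
  have "u ^ ?\<rho> E * w ^ (card E - ?\<rho> E) * ((q * w / u) ^ (?\<rho> E - ?\<rho> B) * (u / w) ^ (card B - ?\<rho> B))
      = u ^ card B * (w ^ m * w ^ k / w ^ l) * q ^ (?\<rho> E - ?\<rho> B)"
    unfolding EB unfolding k l using nz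
    by (simp add: power_add power_divide power_mult_distrib field_simps)
  then show "u ^ ?\<rho> E * w ^ (card E - ?\<rho> E) * ((q * w / u) ^ (?\<rho> E - ?\<rho> B) * (u / w) ^ (card B - ?\<rho> B))
      = u ^ card B * w ^ (card E - card B) * q ^ (?\<rho> E - ?\<rho> B)"
    unfolding w .
qed

section \<open>The five identities from the count of vanishing flows\<close>

text \<open>The interface between the two settings and the evaluation of \<open>root_sum\<close>:
  all that is kept of the matrices is how many flows vanish on a given set.\<close>

locale flow_counting =
  fixes E :: "'e set" and flow :: "('e \<Rightarrow> 'a::{ab_group_add,finite}) \<Rightarrow> bool"
    and indep :: "'e set \<Rightarrow> bool"
  assumes finite_edges: "finite E"
    and indep_empty: "indep {}"
    and flow_restrict: "\<And>h. flow (restrict h E) \<longleftrightarrow> flow h"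
    and card_flows_vanishing: "\<And>B. B \<subseteq> E \<Longrightarrow>
      card {h \<in> E \<rightarrow>\<^sub>E UNIV. flow h \<and> (\<forall>e\<in>B. h e = 0)} =
        CARD('a) ^ (matroid_rank indep E - matroid_rank indep B)"
begin

text \<open>An edge contributes \<omega> when the truth table \<open>P\<close> puts it into the
  result and 1 otherwise, so each summand is a product over edges. After summing over the value of
  \<open>g\<close> at an edge, its factor is \<open>u + w\<close> where the flow vanishes and
  \<open>w\<close> elsewhere.\<close>

lemma root_sum_rank_polynomial:
  fixes \<omega> :: complex
  assumes "\<omega> ^ \<sigma> = 1" "\<sigma> > 0"
    and opr: "\<And>(f :: 'e \<Rightarrow> 'a) (g :: 'e \<Rightarrow> 'a). opr (supp E f) (supp E g) = {e\<in>E. P (f e \<noteq> 0) (g e \<noteq> 0)}"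
  defines "p \<equiv> \<lambda>x y. if P x y then \<omega> else 1"
  assumes w: "w = p True False + p False True + (of_nat CARD('a) - 2) * p True True"
    and u: "u = p False False + (of_nat CARD('a) - 1) * p True True - w"
    and nz: "u \<noteq> 0" "w \<noteq> 0"
  shows "root_sum \<sigma> \<omega> E flow opr = u ^ matroid_rank indep E * w ^ (card E - matroid_rank indep E)
    * rank_polynomial E indep (of_nat CARD('a) * w / u) (u / w)"
proof -
  let ?F = "{h \<in> E \<rightarrow>\<^sub>E UNIV. flow h}"
  have finF: "finite ?F" using finite_edges by (simp add: finite_PiE)
  have "\<omega> ^ card (opr (supp E f) (supp E g)) = (\<Prod>e\<in>E. p (f e \<noteq> 0) (g e \<noteq> 0))" for f g :: "'e \<Rightarrow> 'a"
    unfolding opr p_def using finite_edges by (simp add: prod.If_cases Int_def)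
  then have "root_sum \<sigma> \<omega> E flow opr
      = (\<Sum>h\<in>?F. \<Prod>e\<in>E. \<Sum>b\<in>UNIV. p (h e + b \<noteq> 0) (b \<noteq> 0))"
    using root_sum_eq_sum_pairs[OF assms(1,2) finite_edges, of flow opr]
      sum_pairs_eq_sum_flows[of E flow "\<lambda>x y. p (x \<noteq> 0) (y \<noteq> 0)", OF finite_edges flow_restrict] by simp
  also have "\<dots> = (\<Sum>h\<in>?F. \<Prod>e\<in>E. if h e = 0 then u + w else w)"
    unfolding sum_translated_pair_weights u by (intro sum.cong prod.cong refl) (simp add: w)
  also have "\<dots> = (\<Sum>B\<in>Pow E. u ^ card B * w ^ (card E - card B) *
      of_nat CARD('a) ^ (matroid_rank indep E - matroid_rank indep B))"
    unfolding sum_flows_eq_sum_subsets[OF finite_edges finF]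
    using card_flows_vanishing by (intro sum.cong refl) (simp add: conj_assoc)
  also have "\<dots> = u ^ matroid_rank indep E * w ^ (card E - matroid_rank indep E)
      * rank_polynomial E indep (of_nat CARD('a) * w / u) (u / w)"
    using rank_polynomial_scaled[of E indep u w "of_nat CARD('a)", OF finite_edges indep_empty nz] by simp
  finally show ?thesis .
qed

text \<open>Each identity comes from the truth table of its operation; for union,
  \<open>w = \<omega> * q\<close> and \<open>u = 1 - \<omega>\<close>. The extra conditions say
  \<open>w \<noteq> 0\<close>, which is automatic for union and the Sheffer stroke, and
  \<open>u \<noteq> 0\<close> amounts to \<open>\<omega> \<noteq> 1\<close>.\<close>

lemma root_sum_formulas:
  fixes \<omega> :: complex
  assumes "\<sigma> > 1" and root: "primitive_root_of_unity \<sigma> \<omega>"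
    and r: "r = matroid_rank indep E" and q: "q = CARD('a)"
  shows "root_sum \<sigma> \<omega> E flow (\<union>)
      = (1 - \<omega>) ^ r * (\<omega> * of_nat q) ^ (card E - r)
        * rank_polynomial E indep (\<omega> * (of_nat q)\<^sup>2 / (1 - \<omega>)) ((1 - \<omega>) / (\<omega> * of_nat q))"
    and "2 + \<omega> * (of_nat q - 2) \<noteq> 0 \<Longrightarrow> root_sum \<sigma> \<omega> E flow (\<inter>)
      = (\<omega> - 1) ^ r * (2 + \<omega> * (of_nat q - 2)) ^ (card E - r)
        * rank_polynomial E indep (of_nat q * (2 + \<omega> * (of_nat q - 2)) / (\<omega> - 1))
            ((\<omega> - 1) / (2 + \<omega> * (of_nat q - 2)))"
    and "2 * \<omega> + of_nat q - 2 \<noteq> 0 \<Longrightarrow> root_sum \<sigma> \<omega> E flow sym_diff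
      = (2 - 2 * \<omega>) ^ r * (2 * \<omega> + of_nat q - 2) ^ (card E - r)
        * rank_polynomial E indep (of_nat q * (2 * \<omega> + of_nat q - 2) / (2 - 2 * \<omega>))
            ((2 - 2 * \<omega>) / (2 * \<omega> + of_nat q - 2))"
    and "root_sum \<sigma> \<omega> E flow (sheffer E)
      = (\<omega> - 1) ^ r * (of_nat q) ^ (card E - r)
        * rank_polynomial E indep ((of_nat q)\<^sup>2 / (\<omega> - 1)) ((\<omega> - 1) / of_nat q)"
    and "1 + \<omega> * (of_nat q - 1) \<noteq> 0 \<Longrightarrow> root_sum \<sigma> \<omega> E flow (set_imp E)
      = (\<omega> - 1) ^ r * (1 + \<omega> * (of_nat q - 1)) ^ (card E - r)
        * rank_polynomial E indep (of_nat q * (1 + \<omega> * (of_nat q - 1)) / (\<omega> - 1))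
            ((\<omega> - 1) / (1 + \<omega> * (of_nat q - 1)))"
proof -
  \<comment> \<open>As \<open>\<sigma> > 1\<close>, primitivity applies to the exponent 1 and
    excludes \<open>\<omega> = 1\<close>.\<close>
  have one: "\<omega> ^ \<sigma> = 1" "\<sigma> > 0" and "\<omega> ^ 1 \<noteq> 1"
    using root assms(1) unfolding primitive_root_of_unity_def by auto
  then have \<omega>1: "\<omega> \<noteq> 1" by simp
  have \<omega>0: "\<omega> \<noteq> 0" using one by (metis power_0_left zero_neq_one neq0_conv)
  have q0: "(of_nat q :: complex) \<noteq> 0" unfolding q by simp
  note formula = root_sum_rank_polynomial[OF one, folded r q]
  show "root_sum \<sigma> \<omega> E flow (\<union>)
      = (1 - \<omega>) ^ r * (\<omega> * of_nat q) ^ (card E - r)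
        * rank_polynomial E indep (\<omega> * (of_nat q)\<^sup>2 / (1 - \<omega>)) ((1 - \<omega>) / (\<omega> * of_nat q))"
  proof -
    have "root_sum \<sigma> \<omega> E flow (\<union>)
      = (1 - \<omega>) ^ r * (\<omega> * of_nat q) ^ (card E - r)
        * rank_polynomial E indep (of_nat q * (\<omega> * of_nat q) / (1 - \<omega>)) ((1 - \<omega>) / (\<omega> * of_nat q))"
      by (rule formula[where P = "(\<or>)"])
        (use \<omega>1 \<omega>0 q0 in \<open>auto simp: supp_def algebra_simps\<close>)
    then show ?thesis by (simp add: power2_eq_square mult_ac)
  qed
  show "root_sum \<sigma> \<omega> E flow (\<inter>)
      = (\<omega> - 1) ^ r * (2 + \<omega> * (of_nat q - 2)) ^ (card E - r)
        * rank_polynomial E indep (of_nat q * (2 + \<omega> * (of_nat q - 2)) / (\<omega> - 1))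
            ((\<omega> - 1) / (2 + \<omega> * (of_nat q - 2)))" if "2 + \<omega> * (of_nat q - 2) \<noteq> 0"
    using that by (intro formula[where P = "(\<and>)"])
      (use \<omega>1 in \<open>auto simp: supp_def algebra_simps\<close>)
  show "root_sum \<sigma> \<omega> E flow sym_diff
      = (2 - 2 * \<omega>) ^ r * (2 * \<omega> + of_nat q - 2) ^ (card E - r)
        * rank_polynomial E indep (of_nat q * (2 * \<omega> + of_nat q - 2) / (2 - 2 * \<omega>))
            ((2 - 2 * \<omega>) / (2 * \<omega> + of_nat q - 2))" if "2 * \<omega> + of_nat q - 2 \<noteq> 0"
    using that by (intro formula[where P = "(\<noteq>)"])
      (use \<omega>1 in \<open>auto simp: supp_def algebra_simps\<close>)
  show "root_sum \<sigma> \<omega> E flow (sheffer E)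
      = (\<omega> - 1) ^ r * (of_nat q) ^ (card E - r)
        * rank_polynomial E indep ((of_nat q)\<^sup>2 / (\<omega> - 1)) ((\<omega> - 1) / of_nat q)"
    unfolding power2_eq_square
    by (rule formula[where P = "\<lambda>x y. \<not> (x \<or> y)"])
      (use \<omega>1 q0 in \<open>auto simp: supp_def sheffer_def algebra_simps\<close>)
  show "root_sum \<sigma> \<omega> E flow (set_imp E)
      = (\<omega> - 1) ^ r * (1 + \<omega> * (of_nat q - 1)) ^ (card E - r)
        * rank_polynomial E indep (of_nat q * (1 + \<omega> * (of_nat q - 1)) / (\<omega> - 1))
            ((\<omega> - 1) / (1 + \<omega> * (of_nat q - 1)))" if "1 + \<omega> * (of_nat q - 1) \<noteq> 0"
    using that by (intro formula[where P = "(\<longrightarrow>)"])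
      (use \<omega>1 in \<open>auto simp: supp_def set_imp_def algebra_simps\<close>)
qed

end

section \<open>Flows of orthogonally dual matrices\<close>

text \<open>Writing integers as differences of natural numbers reduces the module laws to those of
  the repeated sum \<open>N\<close>.\<close>

lemma Modules_module_int_scale: "Modules.module (int_scale :: int \<Rightarrow> 'a::ab_group_add \<Rightarrow> 'a)"
proof -
  define N where "N k a = (\<Sum>_<k. a)" for k :: nat and a :: 'a
  have N_add: "N (j + k) a = N j a + N k a" for j k a
    by (induction k) (simp_all add: N_def add.assoc)
  have N_mult: "N (j * k) a = N j (N k a)" for j k a
  proof (induction j)
    case (Suc j)
    have "N (Suc j * k) a = N k a + N (j * k) a" by (simp add: N_add)
    with Suc show ?case by (simp add: N_def add.commute)
  qed (simp add: N_def)
  have N_plus: "N k (a + b) = N k a + N k b" and N_diff: "N k (a - b) = N k a - N k b" for k a b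
    by (simp_all add: N_def sum.distrib sum_subtractf)
  \<comment> \<open>The value does not depend on how the integer is written as a difference, so no
    case distinction on signs is needed in the module laws.\<close>
  have scale: "int_scale (int j - int k) a = N j a - N k a" for j k a
  proof (cases "k \<le> j")
    case True
    then obtain d where "j = k + d" using le_Suc_ex by blast
    then show ?thesis by (simp add: int_scale_def N_add) (simp add: N_def)
  next
    case False
    then obtain d where "k = j + d" using le_Suc_ex nat_le_linear by blast
    then show ?thesis by (simp add: int_scale_def N_add) (simp add: N_def)
  qed
  have rep: "\<exists>j k. n = int j - int k" for n
    by (intro exI[of _ "nat n"] exI[of _ "nat (- n)"]) simp
  show ?thesis
  proof
    fix m n :: int and a b :: 'a
    obtain j k where m: "m = int j - int k" using rep by blast
    obtain j' k' where n: "n = int j' - int k'" using rep by blast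
    show "int_scale m (a + b) = int_scale m a + int_scale m b"
      unfolding m scale N_plus by simp
    have "m + n = int (j + j') - int (k + k')" unfolding m n by simp
    then show "int_scale (m + n) a = int_scale m a + int_scale n a"
      by (simp only: scale N_add m n) simp
    have "m * n = int (j * j' + k * k') - int (j * k' + k * j')"
      unfolding m n by (simp add: algebra_simps)
    then show "int_scale m (int_scale n a) = int_scale (m * n) a"
      by (simp only: scale N_add N_mult N_diff m n) (simp add: algebra_simps)
    show "int_scale 1 a = a" by (simp add: int_scale_def)
  qed
qed

lemma Modules_module_vector_scalar_mult:
  "Modules.module ((*s) :: 'f::field \<Rightarrow> 'f ^ 'd::finite \<Rightarrow> 'f ^ 'd)"
  by standard (simp_all add: Finite_Cartesian_Product.vec_eq_iff vector_scalar_mult_def algebra_simps)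

text \<open>\<open>indep\<close> is kept apart from \<open>independent_columns I G\<close> because,
  for integer matrices, the matroid is taken over the rationals and the count over the integers. The
  two need to agree only on subsets of \<open>E\<close>.\<close>

lemma flow_counting_annihilating_functions:
  fixes flow :: "('e \<Rightarrow> 'a::{ab_group_add,finite}) \<Rightarrow> bool"
  assumes "Modules.module smul" "finite E" "ring_closed_columns I E G"
    and flows: "{h \<in> E \<rightarrow>\<^sub>E UNIV. flow h} = annihilating_functions smul I E G"
    and "\<And>h. flow (restrict h E) \<longleftrightarrow> flow h"
    and rank: "\<And>X. X \<subseteq> E \<Longrightarrow> indep X \<longleftrightarrow> independent_columns I G X"
  shows "flow_counting E flow indep"
proof
  show "indep {}" using rank[of "{}"] by (simp add: independent_columns_empty)
  fix B assume B: "B \<subseteq> E"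
  have "matroid_rank indep C = matroid_rank (independent_columns I G) C" if "C \<subseteq> E" for C
  proof -
    have "{card X |X. X \<subseteq> C \<and> indep X} = {card X |X. X \<subseteq> C \<and> independent_columns I G X}"
      using rank that by (metis subset_trans)
    then show ?thesis by (simp add: matroid_rank_def)
  qed
  moreover have "{h \<in> E \<rightarrow>\<^sub>E UNIV. flow h \<and> (\<forall>e\<in>B. h e = 0)}
      = {h \<in> annihilating_functions smul I E G. \<forall>e\<in>B. h e = 0}"
    unfolding flows[symmetric] by auto
  ultimately show "card {h \<in> E \<rightarrow>\<^sub>E UNIV. flow h \<and> (\<forall>e\<in>B. h e = 0)} =
      CARD('a) ^ (matroid_rank indep E - matroid_rank indep B)"
    using card_annihilating_functions_rank[OF assms(1-3) B] B by simp
qed (use assms in auto)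

lemma is_flow_restrict: "is_flow smul J E H (restrict h E) \<longleftrightarrow> is_flow smul J E H h"
  by (simp add: is_flow_def cong: sum.cong)

lemma annihilating_functions_subset_flows:
  assumes "\<And>j i. j \<in> J \<Longrightarrow> i \<in> I \<Longrightarrow> (\<Sum>e\<in>E. H j e * G i e) = 0"
  shows "annihilating_functions smul I E G \<subseteq> {h \<in> E \<rightarrow>\<^sub>E UNIV. is_flow smul J E H h}"
  using assms unfolding annihilating_functions_def is_flow_def by blast

text \<open>Orthogonality makes each row of \<open>H\<close> a relation between the columns of
  \<open>G\<close>, giving one inclusion. By primitivity every integer relation is an integer
  combination of rows of \<open>H\<close>, giving the other.\<close>

lemma int_flows_eq_annihilating_functions:
  fixes E :: "'e set" and G :: "'i \<Rightarrow> 'e \<Rightarrow> int" and H :: "'j \<Rightarrow> 'e \<Rightarrow> int"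
  assumes dual: "int_orthogonally_dual I J E G H"
  shows "{h \<in> E \<rightarrow>\<^sub>E (UNIV :: 'a::ab_group_add set). is_flow int_scale J E H h} =
    annihilating_functions int_scale I E G"
proof (rule equalityI)
  interpret Modules.module "int_scale :: int \<Rightarrow> 'a \<Rightarrow> 'a" by (rule Modules_module_int_scale)
  have "(\<Sum>e\<in>E. H j e * G i e) = 0" if "j \<in> J" "i \<in> I" for j i
  proof -
    have "rat_of_int (\<Sum>e\<in>E. H j e * G i e) = (\<Sum>e\<in>E. rat_matrix H j e * rat_matrix G i e)" by simp
    also have "\<dots> = 0"
      using dual that unfolding int_orthogonally_dual_def orthogonally_dual_def by blast
    finally show ?thesis by (simp only: of_int_eq_0_iff)
  qed
  then show "annihilating_functions int_scale I E G \<subseteq> {h \<in> E \<rightarrow>\<^sub>E (UNIV :: 'a set). is_flow int_scale J E H h}"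
    by (rule annihilating_functions_subset_flows)
  show "{h \<in> E \<rightarrow>\<^sub>E (UNIV :: 'a set). is_flow int_scale J E H h} \<subseteq> annihilating_functions int_scale I E G"
  proof
    fix h :: "'e \<Rightarrow> 'a" assume h: "h \<in> {h \<in> E \<rightarrow>\<^sub>E UNIV. is_flow int_scale J E H h}"
    have "(\<Sum>e\<in>E. int_scale (x e) (h e)) = 0" if x: "\<forall>i\<in>I. (\<Sum>e\<in>E. x e * G i e) = 0" for x
    proof -
      obtain c where c: "\<And>e. e \<in> E \<Longrightarrow> x e = (\<Sum>j\<in>J. c j * H j e)"
        using dual x unfolding int_orthogonally_dual_def by blast
      have "(\<Sum>e\<in>E. int_scale (x e) (h e)) = (\<Sum>e\<in>E. \<Sum>j\<in>J. int_scale (c j) (int_scale (H j e) (h e)))"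
        by (intro sum.cong refl) (simp add: c scale_sum_left)
      also have "\<dots> = (\<Sum>j\<in>J. int_scale (c j) (\<Sum>e\<in>E. int_scale (H j e) (h e)))"
        unfolding scale_sum_right by (rule sum.swap)
      also have "\<dots> = 0" using h by (simp add: is_flow_def)
      finally show ?thesis .
    qed
    with h show "h \<in> annihilating_functions int_scale I E G"
      unfolding annihilating_functions_def by blast
  qed
qed

text \<open>Over a finite field both sides are counted: an \<open>H\<close>-flow is determined by its values
  outside a column basis of \<open>H\<close>, so there are no more \<open>H\<close>-flows than annihilating functions.\<close>

lemma field_flows_eq_annihilating_functions:
  fixes E :: "'e set" and G :: "'i \<Rightarrow> 'e \<Rightarrow> 'f::{field,finite}" and H :: "'j \<Rightarrow> 'e \<Rightarrow> 'f"
  assumes fin: "finite E" and dual: "orthogonally_dual I J E G H"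
  shows "{h \<in> E \<rightarrow>\<^sub>E (UNIV :: ('f ^ 'd::finite) set). is_flow (*s) J E H h} =
    annihilating_functions (*s) I E G"
proof (rule sym, rule card_seteq)
  let ?F = "{h \<in> E \<rightarrow>\<^sub>E (UNIV :: ('f ^ 'd) set). is_flow (*s) J E H h}"
  let ?r = "matroid_rank (column_matroid I G) E"
  show "finite ?F" using fin by (simp add: finite_PiE)
  show "annihilating_functions (*s) I E G \<subseteq> ?F"
    using dual unfolding orthogonally_dual_def by (intro annihilating_functions_subset_flows) blast
  \<comment> \<open>With \<open>B\<close> empty, the count of functions vanishing on
    \<open>B\<close> becomes the count of all annihilating functions.\<close>
  have "matroid_rank (independent_columns I G) {} = 0"
    using matroid_rank_bounds(2)[of "{}" "independent_columns I G" "{}"]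
    by (simp add: independent_columns_empty)
  then have count: "card (annihilating_functions (*s) I E G :: ('e \<Rightarrow> 'f ^ 'd) set) = CARD('f ^ 'd) ^ ?r"
    using card_annihilating_functions_rank[OF
        Modules_module_vector_scalar_mult[where 'f = 'f and 'd = 'd] fin
        ring_closed_columns_field[OF fin], of "{}" I G]
    by (simp add: column_matroid_eq_independent_columns)
  obtain W where W: "W \<subseteq> E" "column_matroid J H W" "card W = matroid_rank (column_matroid J H) E"
    using matroid_rank_attained[of E "column_matroid J H"] fin independent_columns_empty
    unfolding column_matroid_eq_independent_columns by metis
  have finW: "finite W" using W(1) fin finite_subset by blast
  have cW: "card (E - W) = ?r"
  proof -
    have "?r + card W = card E"
      using dual unfolding orthogonally_dual_def W(3) by (rule conjunct2)
    then show ?thesis by (simp add: card_Diff_subset[OF finW W(1)] flip: \<open>?r + card W = card E\<close>)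
  qed
  have "inj_on (\<lambda>h. restrict h (E - W)) ?F"
  proof (rule inj_onI)
    fix h h' assume h: "h \<in> ?F" "h' \<in> ?F" "restrict h (E - W) = restrict h' (E - W)"
    have eq: "h e = h' e" if "e \<in> E - W" for e
      using fun_cong[OF h(3), of e] that by simp
    have "h e = h' e" if e: "e \<in> W" for e
    proof -
      \<comment> \<open>In each coordinate \<open>k\<close> the difference of the two flows is a
        relation between the columns of \<open>H\<close> that is supported on the independent set
        \<open>W\<close>.\<close>
      have "vec_nth (h e) k - vec_nth (h' e) k = 0" for k
      proof (rule independent_columnsD[OF W(2)[unfolded column_matroid_eq_independent_columns] _ e])
        fix j assume j: "j \<in> J"
        have flow0: "(\<Sum>e\<in>E. H j e * vec_nth (g e) k) = 0" if "g \<in> ?F" for g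
        proof -
          have "(\<Sum>e\<in>E. H j e *s g e) = 0" using that j by (simp add: is_flow_def)
          from arg_cong[OF this, of "\<lambda>v. vec_nth v k"] show ?thesis by simp
        qed
        have "(\<Sum>e\<in>W. (vec_nth (h e) k - vec_nth (h' e) k) * H j e)
            = (\<Sum>e\<in>E. (vec_nth (h e) k - vec_nth (h' e) k) * H j e)"
          using W(1) fin eq by (intro sum.mono_neutral_left) auto
        also have "\<dots> = (\<Sum>e\<in>E. H j e * vec_nth (h e) k) - (\<Sum>e\<in>E. H j e * vec_nth (h' e) k)"
          by (simp add: sum_subtractf algebra_simps)
        also have "\<dots> = 0" using flow0 h(1,2) by simp
        finally show "(\<Sum>e\<in>W. (vec_nth (h e) k - vec_nth (h' e) k) * H j e) = 0" .
      qed
      then show ?thesis by (simp add: Finite_Cartesian_Product.vec_eq_iff)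
    qed
    with eq have "\<And>e. e \<in> E \<Longrightarrow> h e = h' e" by blast
    then show "h = h'" using h(1,2) by (auto intro: PiE_ext)
  qed
  moreover have "(\<lambda>h. restrict h (E - W)) ` ?F \<subseteq> (E - W) \<rightarrow>\<^sub>E (UNIV :: ('f ^ 'd) set)"
    by (rule image_subsetI, subst restrict_PiE_iff, simp)
  moreover have "finite ((E - W) \<rightarrow>\<^sub>E (UNIV :: ('f ^ 'd) set))" using fin by (simp add: finite_PiE)
  ultimately have "card ?F \<le> card ((E - W) \<rightarrow>\<^sub>E (UNIV :: ('f ^ 'd) set))"
    by (rule card_inj_on_le)
  also have "\<dots> = CARD('f ^ 'd) ^ ?r" using fin cW by (simp add: card_funcsetE)
  finally show "card ?F \<le> card (annihilating_functions (*s) I E G :: ('e \<Rightarrow> 'f ^ 'd) set)"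
    unfolding count .
qed

lemma flow_counting_int:
  fixes G :: "'i \<Rightarrow> 'e \<Rightarrow> int"
  assumes "finite E"
    and G: "vertex_edge_matrix D I E G \<or> cycle_edge_matrix D I E G \<or> totally_unimodular I E G"
    and dual: "int_orthogonally_dual I J E G H"
  shows "flow_counting E (is_flow int_scale J E H :: ('e \<Rightarrow> 'a::{ab_group_add,finite}) \<Rightarrow> bool)
    (column_matroid I (rat_matrix G))"
proof (rule flow_counting_annihilating_functions)
  show "ring_closed_columns I E G"
    using G ring_closed_columns_totally_unimodular[OF assms(1)]
      totally_unimodular_vertex_edge_matrix ring_closed_columns_cycle_edge by blast
  show "column_matroid I (rat_matrix G) X \<longleftrightarrow> independent_columns I G X" if "X \<subseteq> E" for X
    unfolding column_matroid_eq_independent_columns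
    using that assms(1) by (intro independent_columns_rat_matrix) (rule finite_subset)
qed (fact Modules_module_int_scale assms(1) is_flow_restrict int_flows_eq_annihilating_functions[OF dual])+

lemma flow_counting_field:
  fixes G :: "'i \<Rightarrow> 'e \<Rightarrow> 'f::{field,finite}"
  assumes "finite E" and dual: "orthogonally_dual I J E G H"
  shows "flow_counting E (is_flow (*s) J E H :: ('e \<Rightarrow> 'f ^ 'd::finite) \<Rightarrow> bool) (column_matroid I G)"
proof (rule flow_counting_annihilating_functions)
  show "ring_closed_columns I E G" using assms(1) by (rule ring_closed_columns_field)
  show "column_matroid I G X \<longleftrightarrow> independent_columns I G X" for X
    unfolding column_matroid_eq_independent_columns ..
qed (fact Modules_module_vector_scalar_mult assms(1) is_flow_restrict
    field_flows_eq_annihilating_functions[OF assms])+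

theorem theorem4p16:
  fixes \<sigma> q r p s :: nat and \<omega> :: complex
    and E :: "'e set" and I :: "'i set" and J :: "'j set"
    and D :: "('v, 'e) pre_digraph"
    and G :: "'i \<Rightarrow> 'e \<Rightarrow> int" and H :: "'j \<Rightarrow> 'e \<Rightarrow> int"
    and G' :: "'i \<Rightarrow> 'e \<Rightarrow> 'f :: {field, finite}" and H' :: "'j \<Rightarrow> 'e \<Rightarrow> 'f"
  assumes "\<sigma> > 1" and "primitive_root_of_unity \<sigma> \<omega>"
    and "finite E" and "finite I" and "finite J"
  shows
   "(vertex_edge_matrix D I E G \<or> cycle_edge_matrix D I E G \<or> totally_unimodular I E G \<longrightarrow>
     int_orthogonally_dual I J E G H \<longrightarrow>
     r = matroid_rank (column_matroid I (rat_matrix G)) E \<longrightarrow>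
     q = CARD('a :: {ab_group_add, finite}) \<longrightarrow>
       (root_sum \<sigma> \<omega> E (is_flow int_scale J E H :: ('e \<Rightarrow> 'a) \<Rightarrow> bool) (\<union>)
          = (1 - \<omega>) ^ r * (\<omega> * of_nat q) ^ (card E - r)
            * rank_polynomial E (column_matroid I (rat_matrix G)) (\<omega> * (of_nat q)\<^sup>2 / (1 - \<omega>)) ((1 - \<omega>) / (\<omega> * of_nat q))) \<and>
       (2 + \<omega> * (of_nat q - 2) \<noteq> 0 \<longrightarrow> root_sum \<sigma> \<omega> E (is_flow int_scale J E H :: ('e \<Rightarrow> 'a) \<Rightarrow> bool) (\<inter>)
          = (\<omega> - 1) ^ r * (2 + \<omega> * (of_nat q - 2)) ^ (card E - r)
            * rank_polynomial E (column_matroid I (rat_matrix G)) (of_nat q * (2 + \<omega> * (of_nat q - 2)) / (\<omega> - 1)) ((\<omega> - 1) / (2 + \<omega> * (of_nat q - 2)))) \<and>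
       (2 * \<omega> + of_nat q - 2 \<noteq> 0 \<longrightarrow> root_sum \<sigma> \<omega> E (is_flow int_scale J E H :: ('e \<Rightarrow> 'a) \<Rightarrow> bool) sym_diff
          = (2 - 2 * \<omega>) ^ r * (2 * \<omega> + of_nat q - 2) ^ (card E - r)
            * rank_polynomial E (column_matroid I (rat_matrix G)) (of_nat q * (2 * \<omega> + of_nat q - 2) / (2 - 2 * \<omega>)) ((2 - 2 * \<omega>) / (2 * \<omega> + of_nat q - 2))) \<and>
       (root_sum \<sigma> \<omega> E (is_flow int_scale J E H :: ('e \<Rightarrow> 'a) \<Rightarrow> bool) (sheffer E)
          = (\<omega> - 1) ^ r * (of_nat q) ^ (card E - r)
            * rank_polynomial E (column_matroid I (rat_matrix G)) ((of_nat q)\<^sup>2 / (\<omega> - 1)) ((\<omega> - 1) / of_nat q)) \<and>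
       (1 + \<omega> * (of_nat q - 1) \<noteq> 0 \<longrightarrow> root_sum \<sigma> \<omega> E (is_flow int_scale J E H :: ('e \<Rightarrow> 'a) \<Rightarrow> bool) (set_imp E)
          = (\<omega> - 1) ^ r * (1 + \<omega> * (of_nat q - 1)) ^ (card E - r)
            * rank_polynomial E (column_matroid I (rat_matrix G)) (of_nat q * (1 + \<omega> * (of_nat q - 1)) / (\<omega> - 1)) ((\<omega> - 1) / (1 + \<omega> * (of_nat q - 1)))))
    \<and>
    (prime p \<and> CARD('f) = p ^ s \<longrightarrow>
     orthogonally_dual I J E G' H' \<longrightarrow>
     r = matroid_rank (column_matroid I G') E \<longrightarrow>
     q = p ^ (s * CARD('d :: finite)) \<longrightarrow>
       (root_sum \<sigma> \<omega> E (is_flow (*s) J E H' :: ('e \<Rightarrow> 'f ^ 'd) \<Rightarrow> bool) (\<union>)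
          = (1 - \<omega>) ^ r * (\<omega> * of_nat q) ^ (card E - r)
            * rank_polynomial E (column_matroid I G') (\<omega> * (of_nat q)\<^sup>2 / (1 - \<omega>)) ((1 - \<omega>) / (\<omega> * of_nat q))) \<and>
       (2 + \<omega> * (of_nat q - 2) \<noteq> 0 \<longrightarrow> root_sum \<sigma> \<omega> E (is_flow (*s) J E H' :: ('e \<Rightarrow> 'f ^ 'd) \<Rightarrow> bool) (\<inter>)
          = (\<omega> - 1) ^ r * (2 + \<omega> * (of_nat q - 2)) ^ (card E - r)
            * rank_polynomial E (column_matroid I G') (of_nat q * (2 + \<omega> * (of_nat q - 2)) / (\<omega> - 1)) ((\<omega> - 1) / (2 + \<omega> * (of_nat q - 2)))) \<and>
       (2 * \<omega> + of_nat q - 2 \<noteq> 0 \<longrightarrow> root_sum \<sigma> \<omega> E (is_flow (*s) J E H' :: ('e \<Rightarrow> 'f ^ 'd) \<Rightarrow> bool) sym_diff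
          = (2 - 2 * \<omega>) ^ r * (2 * \<omega> + of_nat q - 2) ^ (card E - r)
            * rank_polynomial E (column_matroid I G') (of_nat q * (2 * \<omega> + of_nat q - 2) / (2 - 2 * \<omega>)) ((2 - 2 * \<omega>) / (2 * \<omega> + of_nat q - 2))) \<and>
       (root_sum \<sigma> \<omega> E (is_flow (*s) J E H' :: ('e \<Rightarrow> 'f ^ 'd) \<Rightarrow> bool) (sheffer E)
          = (\<omega> - 1) ^ r * (of_nat q) ^ (card E - r)
            * rank_polynomial E (column_matroid I G') ((of_nat q)\<^sup>2 / (\<omega> - 1)) ((\<omega> - 1) / of_nat q)) \<and>
       (1 + \<omega> * (of_nat q - 1) \<noteq> 0 \<longrightarrow> root_sum \<sigma> \<omega> E (is_flow (*s) J E H' :: ('e \<Rightarrow> 'f ^ 'd) \<Rightarrow> bool) (set_imp E)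
          = (\<omega> - 1) ^ r * (1 + \<omega> * (of_nat q - 1)) ^ (card E - r)
            * rank_polynomial E (column_matroid I G') (of_nat q * (1 + \<omega> * (of_nat q - 1)) / (\<omega> - 1)) ((\<omega> - 1) / (1 + \<omega> * (of_nat q - 1)))))"
  apply (rule conjI; intro impI)
  subgoal premises prems
  proof -
    interpret flow_counting E "is_flow int_scale J E H :: ('e \<Rightarrow> 'a) \<Rightarrow> bool"
        "column_matroid I (rat_matrix G)"
      using assms(3) prems(1,2) by (rule flow_counting_int)
    show ?thesis by (intro conjI impI root_sum_formulas[OF assms(1,2) prems(3,4)])
  qed
  subgoal premises prems
  proof -
    interpret flow_counting E "is_flow (*s) J E H' :: ('e \<Rightarrow> 'f ^ 'd) \<Rightarrow> bool" "column_matroid I G'"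
      using assms(3) prems(2) by (rule flow_counting_field)
    \<comment> \<open>The vector space has \<open>CARD('f) ^ CARD('d)\<close> elements, and
      \<open>CARD('f)\<close> is \<open>p ^ s\<close>.\<close>
    have q: "q = CARD('f ^ 'd)" using prems(1,4) by (simp add: power_mult)
    show ?thesis by (intro conjI impI root_sum_formulas[OF assms(1,2) prems(3) q])
  qed
  done

end
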